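(* Let $g$ be a derivator, $\mathbb F\in\{\mathbb R,\mathbb C\}$, $n\ge 1$ an integer, and let $f:\mathbb R\to\mathbb F$ be an $n-1$ times $g$-differentiable function such that $f^{(k)}_g$ is $g$-absolutely continuous for $k\in\{0,\dots,n-1\}$. Then, for all $t,t_0\in\mathbb R$, $$f(t)=\sum_{k=0}^{n-1}(-1)^kf^{(k)}_g(t_0)\frac{1}{k!}h_{t,k}(t_0)+\int_{t_0}^t(-1)^{n-1}f^{(n)}_g(s)\left(\frac{1}{n!}h_{t,n}\right)_g'(s)\,d\mu_g(s).$$
   Context: A derivator is a left-continuous nondecreasing function $g:\mathbb R\to\mathbb R$; $\mu_g$ is the Lebesgue–Stieltjes measure with $\mu_g([a,b))=g(b)-g(a)$. $\Delta g(t)=g(t^+)-g(t)$, $D_g=\{t:\Delta g(t)>0\}$, and $C_g$ is the (open) set of points having a neighbourhood on which $g$ is constant, written as the disjoint union of its component intervals $(a_m,b_m)$. The $g$-derivative of a function $f$ at $t$ is $f'_g(t)=\lim_{s\to t}\frac{f(s)-f(t)}{g(s)-g(t)}$ if $t\notin D_g\cup C_g$; $f'_g(t)=\lim_{s\to t^+}\frac{f(s)-f(t)}{g(s)-g(t)}$ if $t\in D_g$; $f'_g(t)=\lim_{s\to b_m^+}\frac{f(s)-f(b_m)}{g(s)-g(b_m)}$ if $t\in(a_m,b_m)$; provided the limit can be considered and exists (limits are taken over those $s$ for which the quotient is defined). $f^{(0)}_g=f$ and $f^{(k+1)}_g=(f^{(k)}_g)'_g$. A function $F:[a,b]\to\mathbb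 F$ is $g$-absolutely continuous if for every $\varepsilon>0$ there is $\delta>0$ such that for any finite family of pairwise disjoint open subintervals $(a_m,b_m)$ of $[a,b]$, $\sum(g(b_m)-g(a_m))<\delta$ implies $\sum|F(b_m)-F(a_m)|<\varepsilon$; a function on $\mathbb R$ is called $g$-absolutely continuous if its restriction to each compact interval is. Such functions are $g$-differentiable $\mu_g$-almost everywhere, so $f^{(n)}_g$ is defined $\mu_g$-a.e. Put $\int_x^y f\,d\mu_g=\int_{[x,y)}f\,d\mu_g$ if $y\ge x$ and $-\int_{[y,x)}f\,d\mu_g$ if $y<x$. For $t_0\in\mathbb R$ define $h_{t_0,0}(t)=1$ and, for $n\ge1$, $h_{t_0,n}(t)=n\int_{t_0}^t\left[h_{t_0,n-1}+(h_{t_0,n-1})'_g\,\Delta g\right]d\mu_g$, $t\in\mathbb R$ (each $h_{t_0,n}$ is $g$-absolutely continuous on compact intervals, so this is well defined). *)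

theory Defs
  imports "HOL-Analysis.Analysis"
begin

text \<open>
  Scalars: the types in the sort \<open>{real_normed_field, euclidean_space}\<close> are, up to isometric
  isomorphism, exactly \<open>real\<close> and \<open>complex\<close> (finite-dimensional real normed fields), so this
  sort expresses the choice of the field of real or complex numbers.
\<close>

definition derivator :: "(real \<Rightarrow> real) \<Rightarrow> bool" where
  "derivator g \<longleftrightarrow> mono g \<and> (\<forall>t. continuous (at_left t) g)"

text \<open>
  The library's \<^const>\<open>interval_measure\<close> expects a right-continuous function and measures
  half-open intervals \<open>(a, b]\<close>. For a left-continuous \<open>g\<close> we apply it to the right-continuous
  function \<open>x \<mapsto> - g (- x)\<close> and reflect the result; lemma \<open>emeasure_stieltjes_measure\<close> below
  confirms that \<open>[a, b)\<close> gets measure \<open>g b - g a\<close>. The measure is completed because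
  \<open>g\<close>-derivatives are in general only defined almost everywhere: the values of the total
  function \<open>g_deriv\<close> on the exceptional null set then do not affect measurability.
\<close>

definition stieltjes_measure :: "(real \<Rightarrow> real) \<Rightarrow> real measure" where
  "stieltjes_measure g =
     completion (distr (interval_measure (\<lambda>x. - g (- x))) borel uminus)"

lemma emeasure_stieltjes_measure:
  assumes "derivator g" and "a \<le> b"
  shows "emeasure (stieltjes_measure g) {a..<b} = ennreal (g b - g a)"
proof -
  let ?G = "\<lambda>x. - g (- x)"
  have mono: "?G x \<le> ?G y" if "x \<le> y" for x y
    using assms(1) that by (simp add: derivator_def mono_def)
  have right: "continuous (at_right x) ?G" for x
  proof -
    have "(g \<longlongrightarrow> g (- x)) (at_left (- x))"
      using assms(1) by (simp add: derivator_def continuous_within)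
    then have "((\<lambda>y. g (- y)) \<longlongrightarrow> g (- x)) (at_right x)"
      by (simp add: filterlim_at_left_to_right)
    then show ?thesis
      by (auto simp: continuous_within intro: tendsto_minus)
  qed
  have "uminus -` {a..<b} = {- b<..- a}"
    by auto
  then have "emeasure (distr (interval_measure ?G) borel uminus) {a..<b}
      = emeasure (interval_measure ?G) {- b<..- a}"
    by (subst emeasure_distr) auto
  also have "\<dots> = ennreal (?G (- a) - ?G (- b))"
    using assms(2) by (intro emeasure_interval_measure_Ioc mono right) auto
  finally show ?thesis
    by (simp add: stieltjes_measure_def)
qed

definition jump :: "(real \<Rightarrow> real) \<Rightarrow> real \<Rightarrow> real" where
  "jump g t = Lim (at_right t) g - g t"

definition jump_set :: "(real \<Rightarrow> real) \<Rightarrow> real set" where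
  "jump_set g = {t. jump g t > 0}"

definition constancy_set :: "(real \<Rightarrow> real) \<Rightarrow> real set" where
  "constancy_set g = {t. \<exists>U. open U \<and> t \<in> U \<and> g constant_on U}"

text \<open>
  At a point of a bounded-above component \<open>(a\<^sub>m, b\<^sub>m)\<close> of the constancy set the derivative is
  taken at \<open>b\<^sub>m\<close> from the right; on a component unbounded above the limit cannot be considered
  and no derivative exists. All limits range over the \<open>s\<close> with \<open>g s \<noteq> g t\<close>
  (respectively \<open>g s \<noteq> g b\<^sub>m\<close>), where the quotient is defined.
\<close>

definition has_g_deriv ::
  "(real \<Rightarrow> real) \<Rightarrow> (real \<Rightarrow> 'a::real_normed_vector) \<Rightarrow> 'a \<Rightarrow> real \<Rightarrow> bool" where
  "has_g_deriv g f d t \<longleftrightarrow>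
    (if t \<in> constancy_set g then
       (let K = connected_component_set (constancy_set g) t; b = Sup K in
        bdd_above K \<and>
        ((\<lambda>s. (f s - f b) /\<^sub>R (g s - g b)) \<longlongrightarrow> d) (at b within {s. s > b \<and> g s \<noteq> g b}))
     else if t \<in> jump_set g then
       ((\<lambda>s. (f s - f t) /\<^sub>R (g s - g t)) \<longlongrightarrow> d) (at t within {s. s > t \<and> g s \<noteq> g t})
     else
       ((\<lambda>s. (f s - f t) /\<^sub>R (g s - g t)) \<longlongrightarrow> d) (at t within {s. g s \<noteq> g t}))"

definition g_differentiable ::
  "(real \<Rightarrow> real) \<Rightarrow> (real \<Rightarrow> 'a::real_normed_vector) \<Rightarrow> real \<Rightarrow> bool" where
  "g_differentiable g f t \<longleftrightarrow> (\<exists>d. has_g_deriv g f d t)"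

definition g_deriv ::
  "(real \<Rightarrow> real) \<Rightarrow> (real \<Rightarrow> 'a::real_normed_vector) \<Rightarrow> real \<Rightarrow> 'a" where
  "g_deriv g f t = (THE d. has_g_deriv g f d t)"

definition g_deriv_iter ::
  "(real \<Rightarrow> real) \<Rightarrow> nat \<Rightarrow> (real \<Rightarrow> 'a::real_normed_vector) \<Rightarrow> real \<Rightarrow> 'a" where
  "g_deriv_iter g k f = (g_deriv g ^^ k) f"

definition times_g_differentiable ::
  "nat \<Rightarrow> (real \<Rightarrow> real) \<Rightarrow> (real \<Rightarrow> 'a::real_normed_vector) \<Rightarrow> bool" where
  "times_g_differentiable m g f \<longleftrightarrow> (\<forall>k<m. \<forall>t. g_differentiable g (g_deriv_iter g k f) t)"

text \<open>A family of intervals \<open>(x, y)\<close> is represented by the set of its pairs of endpoints.\<close>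

definition g_absolutely_continuous_on ::
  "real \<Rightarrow> real \<Rightarrow> (real \<Rightarrow> real) \<Rightarrow> (real \<Rightarrow> 'a::real_normed_vector) \<Rightarrow> bool" where
  "g_absolutely_continuous_on a b g F \<longleftrightarrow>
    (\<forall>\<epsilon>>0. \<exists>\<delta>>0. \<forall>I.
       finite I \<and> (\<forall>(x, y)\<in>I. a \<le> x \<and> x < y \<and> y \<le> b) \<and>
       disjoint_family_on (\<lambda>(x, y). {x<..<y}) I \<and>
       (\<Sum>(x, y)\<in>I. g y - g x) < \<delta>
       \<longrightarrow> (\<Sum>(x, y)\<in>I. norm (F y - F x)) < \<epsilon>)"

definition g_absolutely_continuous ::
  "(real \<Rightarrow> real) \<Rightarrow> (real \<Rightarrow> 'a::real_normed_vector) \<Rightarrow> bool" where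
  "g_absolutely_continuous g F \<longleftrightarrow> (\<forall>a b. a < b \<longrightarrow> g_absolutely_continuous_on a b g F)"

definition g_integrable ::
  "(real \<Rightarrow> real) \<Rightarrow> real \<Rightarrow> real \<Rightarrow> (real \<Rightarrow> 'a::{banach, second_countable_topology}) \<Rightarrow> bool" where
  "g_integrable g x y f \<longleftrightarrow> set_integrable (stieltjes_measure g) {min x y..<max x y} f"

definition g_integral ::
  "(real \<Rightarrow> real) \<Rightarrow> real \<Rightarrow> real \<Rightarrow> (real \<Rightarrow> 'a::{banach, second_countable_topology}) \<Rightarrow> 'a" where
  "g_integral g x y f =
    (if x \<le> y then (LINT s:{x..<y}|stieltjes_measure g. f s)
     else - (LINT s:{y..<x}|stieltjes_measure g. f s))"

text \<open>
  \<open>g_monomial g t\<^sub>0 n\<close> is the function \<open>h\<^bsub>t\<^sub>0,n\<^esub>\<close>. Off the jump set the factor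
  \<open>jump g s\<close> is zero, so the derivative only matters at jumps, where it exists.
\<close>

primrec g_monomial :: "(real \<Rightarrow> real) \<Rightarrow> real \<Rightarrow> nat \<Rightarrow> real \<Rightarrow> real" where
  "g_monomial g t0 0 = (\<lambda>t. 1)"
| "g_monomial g t0 (Suc n) =
    (\<lambda>t. real (Suc n) *
       g_integral g t0 t (\<lambda>s. g_monomial g t0 n s + g_deriv g (g_monomial g t0 n) s * jump g s))"

end

theory Submission
  imports Defs
begin

text \<open>
  Write \<open>u\<^sub>k\<close> for \<open>h\<^bsub>t,k\<^esub> / k!\<close>. A \<open>g\<close>-absolutely continuous function is the primitive of its
  \<open>g\<close>-derivative: it is dominated by its variation, so each of its components is a difference of
  derivators whose Stieltjes measures have a Radon-Nikodym density, and the density is the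
  \<open>g\<close>-derivative almost everywhere by the Lebesgue differentiation theorem. Since the derivative
  of \<open>u\<^sub>k\<^sub>+\<^sub>1\<close> is almost everywhere the right limit of \<open>u\<^sub>k\<close>, integration by parts shows that
  \<open>(-1)\<^sup>k (f\<^bsup>(k+1)\<^esup> u'\<^sub>k\<^sub>+\<^sub>1 + f\<^bsup>(k)\<^esup> u'\<^sub>k)\<close> is the density of \<open>(-1)\<^sup>k f\<^bsup>(k)\<^esup> u\<^sub>k\<close>. Summing over
  \<open>k < n\<close> telescopes to the integrand of the remainder, and \<open>u\<^sub>k(t) = 0\<close> for \<open>k > 0\<close>.
\<close>

section \<open>A weak-type inequality for measures on the line\<close>

text \<open>Two obstacles shape the argument. \<open>g_deriv\<close> is a definite description whose
  value is known only almost everywhere, so nothing can be computed with it directly. Functions are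
  therefore paired with an explicit Borel density, \<open>g_primitive F \<phi>\<close>; sums,
  products and Fubini act on such pairs over the uncompleted measure, and the derivative is then
  identified with the density almost everywhere. The second obstacle is the jumps. The measure may
  have atoms and is in general not doubling, so enlarging intervals gives no control and covers of
  multiplicity two are used instead. At a jump the increments of \<open>g\<close> over short
  intervals starting there stay away from zero, so absolute continuity does not directly bound the
  variation near such a point. In the product rule the atoms force the right limit of one factor in
  place of its value; the recursion of the monomials contains exactly this right limit, which is why
  the alternating sum telescopes without a correction term.\<close>

lemma finite_interval_family_multiplicity:
  fixes D :: "('a::linorder \<times> 'a) set"
  assumes "finite D"
    and minimal: "\<And>k. k \<in> D \<Longrightarrow> \<not> K \<subseteq> (\<Union>l\<in>D - {k}. {fst l..<snd l})"
    and cover: "K \<subseteq> (\<Union>k\<in>D. {fst k..<snd k})"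
  shows "card {k\<in>D. p \<in> {fst k..<snd k}} \<le> 2"
proof (rule ccontr)
  define S where "S = {k\<in>D. p \<in> {fst k..<snd k}}"
  assume "\<not> card {k\<in>D. p \<in> {fst k..<snd k}} \<le> 2"
  then have card: "card S > 2" by (simp add: S_def)
  have fin: "finite S" using assms(1) by (simp add: S_def)
  have ne: "S \<noteq> {}" using card by auto
  \<comment> \<open>All members of \<open>S\<close> contain \<open>p\<close>, so the one reaching
    furthest left and the one reaching furthest right together cover every other; a third member
    could be dropped from the cover.\<close>
  obtain i where i: "i \<in> S" "\<And>k. k \<in> S \<Longrightarrow> fst i \<le> fst k"
    using ex_min_if_finite[of "fst ` S"] fin ne by (metis (no_types, lifting) arg_min_if_finite(1) arg_min_least)
  obtain j where j: "j \<in> S" "\<And>k. k \<in> S \<Longrightarrow> snd k \<le> snd j"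
  proof -
    have "Max (snd ` S) \<in> snd ` S" using fin ne by (intro Max_in) auto
    then obtain j where "j \<in> S" "snd j = Max (snd ` S)" by force
    then show thesis using fin by (intro that[of j]) auto
  qed
  have "\<not> S \<subseteq> {i, j}"
  proof
    assume "S \<subseteq> {i, j}"
    then have "card S \<le> card {i, j}" by (intro card_mono) auto
    also have "\<dots> \<le> 2" by (simp add: card_insert_if)
    finally show False using card by simp
  qed
  then obtain k where k: "k \<in> S" "k \<noteq> i" "k \<noteq> j" by auto
  have "{fst k..<snd k} \<subseteq> {fst i..<snd i} \<union> {fst j..<snd j}"
  proof
    fix q assume "q \<in> {fst k..<snd k}"
    then have "fst i \<le> q" "q < snd j"
      using i(2)[OF k(1)] j(2)[OF k(1)] by auto
    moreover have "p < snd i" "fst j \<le> p" using i(1) j(1) by (auto simp: S_def)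
    ultimately show "q \<in> {fst i..<snd i} \<union> {fst j..<snd j}"
      by (cases "q \<le> p") (use order.strict_trans1 in auto)
  qed
  moreover have "i \<in> D - {k}" "j \<in> D - {k}" using i j k by (auto simp: S_def)
  ultimately have "(\<Union>k\<in>D. {fst k..<snd k}) \<subseteq> (\<Union>l\<in>D - {k}. {fst l..<snd l})"
    by blast
  then show False using minimal[of k] cover k(1) by (auto simp: S_def)
qed

text \<open>
  A weak-type inequality without any doubling hypothesis: on the line a minimal finite cover by
  intervals has multiplicity at most two.
\<close>

lemma emeasure_interval_cover_le:
  fixes M N :: "real measure" and e :: ennreal
  assumes [simp]: "sets M = sets borel" "sets N = sets borel"
    and U: "U \<in> sets borel"
    and sub: "\<And>x y. (x, y) \<in> I \<Longrightarrow> {x..<y} \<subseteq> U"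
    and le: "\<And>x y. (x, y) \<in> I \<Longrightarrow> e * emeasure M {x..<y} \<le> emeasure N {x..<y}"
  shows "e * emeasure M (\<Union>(x, y)\<in>I. {x<..<y}) \<le> 2 * emeasure N U"
proof -
  define G where "G = (\<Union>(x, y)\<in>I. {x<..<y})"
  have "open G" unfolding G_def by auto
  \<comment> \<open>Compactness uses the open intervals, the measure estimate the half-open ones
    with the same endpoints. Exhaustion by compact sets then recovers \<open>G\<close>.\<close>
  have compact_le: "e * emeasure M K \<le> 2 * emeasure N U" if K: "compact K" "K \<subseteq> G" for K
  proof -
    define P where "P D \<longleftrightarrow> D \<subseteq> I \<and> finite D \<and> K \<subseteq> (\<Union>k\<in>D. {fst k..<snd k})" for D
    have G_eq: "G = (\<Union>k\<in>I. {fst k<..<snd k})" by (simp add: G_def case_prod_beta)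
    obtain D0 where D0: "D0 \<subseteq> I" "finite D0" "K \<subseteq> (\<Union>k\<in>D0. {fst k<..<snd k})"
      using compactE_image[OF K(1), of I "\<lambda>k. {fst k<..<snd k}"] K(2) G_eq by auto
    have "(\<Union>k\<in>D0. {fst k<..<snd k}) \<subseteq> (\<Union>k\<in>D0. {fst k..<snd k})"
      by (intro UN_mono) auto
    with D0 have "P D0" by (auto simp: P_def)
    \<comment> \<open>A subcover of least cardinality is minimal, so the multiplicity bound applies
      to it.\<close>
    then obtain D where "P D" and least: "\<And>D'. P D' \<Longrightarrow> card D \<le> card D'"
      using ex_has_least_nat[of P D0 card] by blast
    then have D: "D \<subseteq> I" "finite D" "K \<subseteq> (\<Union>k\<in>D. {fst k..<snd k})"
      by (auto simp: P_def)
    have mult: "card {k\<in>D. p \<in> {fst k..<snd k}} \<le> 2" for p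
    proof (rule finite_interval_family_multiplicity[OF D(2) _ D(3)])
      fix k assume "k \<in> D"
      then have "card (D - {k}) < card D" using D(2) by (meson card_Diff1_less)
      then show "\<not> K \<subseteq> (\<Union>l\<in>D - {k}. {fst l..<snd l})"
        using least[of "D - {k}"] D by (auto simp: P_def)
    qed
    have "emeasure M K \<le> emeasure M (\<Union>k\<in>D. {fst k..<snd k})"
      using D by (intro emeasure_mono) (auto simp: case_prod_beta)
    also have "\<dots> \<le> (\<Sum>k\<in>D. emeasure M {fst k..<snd k})"
      using D by (intro emeasure_subadditive_finite) auto
    finally have "e * emeasure M K \<le> (\<Sum>k\<in>D. e * emeasure M {fst k..<snd k})"
      by (metis mult_left_mono sum_distrib_left zero_le)
    also have "\<dots> \<le> (\<Sum>k\<in>D. emeasure N {fst k..<snd k})"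
      using D le by (intro sum_mono) auto
    \<comment> \<open>The sum of the measures is the integral of the counting function of the cover,
      which is at most 2 on \<open>U\<close> and 0 elsewhere.\<close>
    also have "\<dots> = (\<integral>\<^sup>+ p. (\<Sum>k\<in>D. indicator {fst k..<snd k} p) \<partial>N)"
      by (subst nn_integral_sum) (auto intro!: borel_measurable_indicator)
    also have "\<dots> \<le> (\<integral>\<^sup>+ p. 2 * indicator U p \<partial>N)"
    proof (rule nn_integral_mono)
      fix p
      have eq: "(\<Sum>k\<in>D. indicator {fst k..<snd k} p) = (of_nat (card {k\<in>D. p \<in> {fst k..<snd k}}) :: ennreal)"
      proof -
        have "(\<Sum>k\<in>D. indicator {fst k..<snd k} p) = (\<Sum>k\<in>D. if p \<in> {fst k..<snd k} then 1 else 0 :: ennreal)"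
          by (intro sum.cong) (auto simp: indicator_def)
        also have "\<dots> = of_nat (card {k\<in>D. p \<in> {fst k..<snd k}})"
          using D(2) by (subst sum.inter_filter[symmetric]) auto
        finally show ?thesis .
      qed
      show "(\<Sum>k\<in>D. indicator {fst k..<snd k} p) \<le> (2 * indicator U p :: ennreal)"
      proof (cases "p \<in> U")
        case True
        have "(of_nat (card {k\<in>D. p \<in> {fst k..<snd k}}) :: ennreal) \<le> of_nat 2"
          using mult[of p] by (simp only: of_nat_le_iff)
        then show ?thesis using True eq by simp
      next
        case False
        then have "{k\<in>D. p \<in> {fst k..<snd k}} = {}"
          using D(1) sub by (metis (no_types, lifting) empty_Collect_eq prod.collapse subsetD)
        then show ?thesis using eq by simp
      qed
    qed
    also have "\<dots> = 2 * emeasure N U"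
      using U by (subst nn_integral_cmult_indicator) auto
    finally show ?thesis .
  qed
  obtain C where C: "\<And>n. compact (C n)" "\<And>n. C n \<subseteq> G"
      "\<And>n. C n \<subseteq> interior (C (Suc n))" "\<Union>(range C) = G"
    using open_Union_compact_subsets[OF \<open>open G\<close>] by metis
  have inc: "incseq C"
    using C(3) interior_subset by (intro incseq_SucI) blast
  have "e * emeasure M G = e * (SUP n. emeasure M (C n))"
    using inc C by (subst SUP_emeasure_incseq) (auto intro: borel_compact)
  also have "\<dots> = (SUP n. e * emeasure M (C n))"
    by (rule SUP_mult_left_ennreal) 
  also have "\<dots> \<le> 2 * emeasure N U"
    using compact_le C by (intro SUP_least) auto
  finally show ?thesis by (simp add: G_def)
qed

section \<open>Differentiation with respect to a derivator\<close>

text \<open>The Borel measure before completion: Fubini, outer regularity and Radon-Nikodym are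
  applied here, and \<open>g_integral_g_primitive\<close> carries the results over to the
  completion.\<close>

definition ls_measure :: "(real \<Rightarrow> real) \<Rightarrow> real measure" where
  "ls_measure g = distr (interval_measure (\<lambda>x. - g (- x))) borel uminus"

lemma stieltjes_measure_eq: "stieltjes_measure g = completion (ls_measure g)"
  by (simp add: stieltjes_measure_def ls_measure_def)

lemma sets_ls_measure [simp, measurable_cong]: "sets (ls_measure g) = sets borel"
  by (simp add: ls_measure_def)

lemma space_ls_measure [simp]: "space (ls_measure g) = UNIV"
  by (simp add: ls_measure_def)

locale derivator_on_line =
  fixes g :: "real \<Rightarrow> real"
  assumes derivator: "derivator g"
begin

lemma mono_g: "x \<le> y \<Longrightarrow> g x \<le> g y"
  using derivator by (simp add: derivator_def mono_def)

lemma g_tendsto_left: "(g \<longlongrightarrow> g x) (at_left x)"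
  using derivator by (simp add: derivator_def continuous_within)

lemma emeasure_Ico: "x \<le> y \<Longrightarrow> emeasure (ls_measure g) {x..<y} = ennreal (g y - g x)"
  using emeasure_stieltjes_measure[OF derivator, of x y] by (simp add: stieltjes_measure_eq)

lemma measure_Ico: "x \<le> y \<Longrightarrow> measure (ls_measure g) {x..<y} = g y - g x"
  using mono_g by (simp add: measure_def emeasure_Ico)

lemma emeasure_Ico_finite: "emeasure (ls_measure g) {x..<y} < \<infinity>"
  by (cases "x \<le> y") (auto simp: emeasure_Ico)

sublocale sigma_finite_measure "ls_measure g"
proof
  let ?A = "range (\<lambda>n::nat. {- real n..<real n})"
  have "\<Union>?A = UNIV"
  proof (intro equalityI subsetI UNIV_I)
    fix x :: real
    obtain n :: nat where "\<bar>x\<bar> < real n" using reals_Archimedean2 by blast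
    then show "x \<in> \<Union>?A" by (auto intro!: exI[of _ n])
  qed
  then show "\<exists>A. countable A \<and> A \<subseteq> sets (ls_measure g) \<and> \<Union>A = space (ls_measure g) \<and>
      (\<forall>a\<in>A. emeasure (ls_measure g) a \<noteq> \<infinity>)"
    using emeasure_Ico_finite by (intro exI[of _ ?A]) (auto simp: less_top[symmetric])
qed

end

text \<open>Outer regularity is available for finite measures, so it is applied to \<open>N\<close>
  restricted to the window, and the open set found is cut back to the window.\<close>

lemma open_superset_small_emeasure:
  fixes N :: "real measure" and e :: ennreal
  assumes [simp]: "sets N = sets borel" and fin: "emeasure N {a<..<b} < \<infinity>"
    and A: "A \<in> null_sets N" "A \<subseteq> {a<..<b}" and "e > 0"
  obtains U where "open U" "A \<subseteq> U" "U \<subseteq> {a<..<b}" "emeasure N U < e"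
proof -
  let ?N = "density N (indicator {a<..<b})"
  have em: "emeasure ?N B = emeasure N ({a<..<b} \<inter> B)" if "B \<in> sets borel" for B
    using that by (subst emeasure_density) (auto simp: indicator_inter_arith[symmetric] borel_measurable_indicator)
  have sp: "space N = UNIV" using sets_eq_imp_space_eq[of N borel] by simp
  have Ab: "A \<in> sets borel" using A(1) by auto
  have "emeasure ?N A = (INF U \<in> {U. A \<subseteq> U \<and> open U}. emeasure ?N U)"
    using fin Ab by (intro outer_regular) (auto simp: em sp)
  moreover have "emeasure ?N A = 0"
    using A em[OF Ab] by (auto simp: Int_absorb1)
  ultimately have "(INF U \<in> {U. A \<subseteq> U \<and> open U}. emeasure ?N U) < e"
    using \<open>e > 0\<close> by simp
  then obtain U where "A \<subseteq> U" "open U" "emeasure ?N U < e"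
    by (auto simp: INF_less_iff)
  then show thesis
    using A(2) em[of U] by (intro that[of "{a<..<b} \<inter> U"]) auto
qed

section \<open>Null sets of one measure have density zero almost everywhere for another\<close>

context derivator_on_line begin

text \<open>Points where the ratio exceeds \<open>e\<close> at arbitrarily small scales are covered
  by intervals inside an open set of \<open>N\<close>-measure below \<open>k\<close>, which exists
  because \<open>A\<close> is \<open>N\<close>-null. The weak-type inequality bounds the
  \<open>g\<close>-measure of this cover by \<open>2 * k / e\<close>, and \<open>k\<close> is
  arbitrary.\<close>

lemma AE_measure_ratio_tendsto_0:
  fixes N :: "real measure"
  assumes sets_N [simp]: "sets N = sets borel"
    and fin: "\<And>n::nat. emeasure N {- real n<..<real n} < \<infinity>"
    and A: "A \<in> null_sets N"
  shows "AE s in ls_measure g. s \<in> A \<longrightarrow> (\<forall>e>0. \<exists>d>0. \<forall>x y. s - d < x \<and> x \<le> s \<and> s < y \<and> y < s + d \<longrightarrow>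
           emeasure N {x..<y} \<le> ennreal (e * (g y - g x)))"
proof -
  define bad where "bad e n = {s \<in> A \<inter> {- real n<..<real n}. \<forall>d>0. \<exists>x y. s - d < x \<and> x \<le> s \<and> s < y \<and> y < s + d \<and>
      emeasure N {x..<y} > ennreal (e * (g y - g x))}" for e and n :: nat
  have Ab: "A \<in> sets borel" using A by auto
  have null: "\<exists>Z\<in>null_sets (ls_measure g). bad e n \<subseteq> Z" if "e > 0" for e n
  proof -
    let ?W = "{- real n<..<real n}"
    have "\<exists>G. open G \<and> bad e n \<subseteq> G \<and> ennreal e * emeasure (ls_measure g) G \<le> 2 * k" if k: "k > 0" for k :: ennreal
    proof -
      have "A \<inter> ?W \<in> null_sets N" using A by (intro null_set_Int2) auto
      then obtain U where U: "open U" "A \<inter> ?W \<subseteq> U" "U \<subseteq> ?W" "emeasure N U < k"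
        using open_superset_small_emeasure[OF sets_N fin[of n], of "A \<inter> ?W" k] k by blast
      define I where "I = {(x, y). x < y \<and> {x..<y} \<subseteq> U \<and> emeasure N {x..<y} > ennreal (e * (g y - g x))}"
      define G where "G = (\<Union>(x, y)\<in>I. {x<..<y})"
      have "bad e n \<subseteq> G"
      proof
        fix s assume s: "s \<in> bad e n"
        then have "s \<in> U" using U(2) by (auto simp: bad_def)
        then obtain d where d: "d > 0" "ball s d \<subseteq> U" using U(1) openE by blast
        obtain x y where xy: "s - d < x" "x \<le> s" "s < y" "y < s + d"
            "emeasure N {x..<y} > ennreal (e * (g y - g x))"
          using s d(1) unfolding bad_def by blast
        \<comment> \<open>The cover has to be open, but \<open>x = s\<close> is allowed. Left
          continuity of \<open>g\<close> lets the left endpoint move to some \<open>x' < x\<close>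
          while the strict inequality survives.\<close>
        have "((\<lambda>x. ennreal (e * (g y - g x))) \<longlongrightarrow> ennreal (e * (g y - g x))) (at_left x)"
          by (intro tendsto_ennrealI tendsto_intros g_tendsto_left)
        then have "eventually (\<lambda>x'. ennreal (e * (g y - g x')) < emeasure N {x..<y}) (at_left x)"
          using xy(5) by (rule order_tendstoD)
        moreover have "eventually (\<lambda>x'. x' \<in> {s - d<..<x}) (at_left x)"
          using xy(1) by (intro eventually_at_leftI[of "s - d"]) auto
        ultimately obtain x' where x': "ennreal (e * (g y - g x')) < emeasure N {x..<y}" "s - d < x'" "x' < x"
          using eventually_happens[OF eventually_conj] trivial_limit_at_left_real by fastforce
        have "emeasure N {x..<y} \<le> emeasure N {x'..<y}"
          using x' by (intro emeasure_mono) auto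
        moreover have "{x'..<y} \<subseteq> U" using d(2) x' xy by (auto simp: subset_eq dist_real_def)
        ultimately have "(x', y) \<in> I" using x' xy by (auto simp: I_def)
        then show "s \<in> G" unfolding G_def using x' xy by (intro UN_I[of "(x', y)"]) auto
      qed
      moreover have "open G" by (auto simp: G_def)
      moreover have "ennreal e * emeasure (ls_measure g) G \<le> 2 * emeasure N U"
        unfolding G_def
      proof (rule emeasure_interval_cover_le)
        show "ennreal e * emeasure (ls_measure g) {x..<y} \<le> emeasure N {x..<y}" if "(x, y) \<in> I" for x y
          using that \<open>e > 0\<close> mono_g[of x y] by (auto simp: I_def emeasure_Ico ennreal_mult)
      qed (use U in \<open>auto simp: I_def\<close>)
      moreover have "2 * emeasure N U \<le> 2 * k" using U(4) by (intro mult_left_mono) auto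
      ultimately show ?thesis by (blast intro: order_trans)
    qed
    then have "\<forall>m. \<exists>G. open G \<and> bad e n \<subseteq> G \<and> ennreal e * emeasure (ls_measure g) G \<le> 2 * ennreal (1 / Suc m)"
      by simp
    then obtain G where G: "\<And>m::nat. open (G m)" "\<And>m. bad e n \<subseteq> G m"
        "\<And>m. ennreal e * emeasure (ls_measure g) (G m) \<le> 2 * ennreal (1 / Suc m)"
      by metis
    have "ennreal e * emeasure (ls_measure g) (\<Inter>m. G m) \<le> 0"
    proof (rule tendsto_lowerbound)
      show "(\<lambda>m. 2 * ennreal (1 / Suc m)) \<longlonglongrightarrow> 0"
      proof -
        have "(\<lambda>m. ennreal (2 * (1 / Suc m))) \<longlonglongrightarrow> ennreal (2 * 0)"
          by (intro tendsto_ennrealI tendsto_intros LIMSEQ_Suc[OF lim_1_over_n])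
        moreover have "ennreal (2 * (1 / Suc m)) = 2 * ennreal (1 / Suc m)" for m
          by (subst ennreal_mult) auto
        ultimately show ?thesis by (simp only: mult_zero_right ennreal_0)
      qed
      have "ennreal e * emeasure (ls_measure g) (\<Inter>m. G m) \<le> 2 * ennreal (1 / Suc m)" for m
      proof -
        have "emeasure (ls_measure g) (\<Inter>m. G m) \<le> emeasure (ls_measure g) (G m)"
          using G(1) by (intro emeasure_mono) auto
        then show ?thesis using G(3)[of m] by (meson mult_left_mono order_trans zero_le)
      qed
      then show "\<forall>\<^sub>F m in sequentially. ennreal e * emeasure (ls_measure g) (\<Inter>m. G m) \<le> 2 * ennreal (1 / Suc m)"
        by simp
    qed auto
    then have "emeasure (ls_measure g) (\<Inter>m. G m) = 0" using \<open>e > 0\<close> by (auto simp: ennreal_eq_0_iff)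
    then have "(\<Inter>m. G m) \<in> null_sets (ls_measure g)"
      using G(1) by (auto simp: null_sets_def)
    then show ?thesis using G(2) by blast
  qed
  \<comment> \<open>Countably many thresholds \<open>1 / (k + 1)\<close> and windows from
    \<open>-n\<close> to \<open>n\<close> reduce the claim for all \<open>e\<close> and
    \<open>s\<close> to a countable union of null sets.\<close>
  define E where "E = (\<lambda>k. 1 / real (Suc k))"
  have "\<exists>Z. Z \<in> null_sets (ls_measure g) \<and> bad (E k) n \<subseteq> Z" for k n
    using null[of "E k" n] by (auto simp: E_def)
  then obtain Z where Z: "\<And>k n. Z k n \<in> null_sets (ls_measure g)" "\<And>k n. bad (E k) n \<subseteq> Z k n"
    by metis
  show ?thesis
  proof (rule AE_I')
    show "(\<Union>k. \<Union>n. Z k n) \<in> null_sets (ls_measure g)"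
      using Z(1) by (intro null_sets_UN)
    show "{s \<in> space (ls_measure g). \<not> (s \<in> A \<longrightarrow> (\<forall>e>0. \<exists>d>0. \<forall>x y. s - d < x \<and> x \<le> s \<and> s < y \<and> y < s + d \<longrightarrow>
           emeasure N {x..<y} \<le> ennreal (e * (g y - g x))))} \<subseteq> (\<Union>k. \<Union>n. Z k n)"
    proof safe
      fix s and e :: real
      assume s: "s \<in> A" "e > 0" "s \<notin> (\<Union>k. \<Union>n. Z k n)"
      obtain k where k: "E k < e" using nat_approx_posE[OF s(2)] by (auto simp: E_def)
      obtain n :: nat where n: "\<bar>s\<bar> < real n" using reals_Archimedean2 by blast
      have "s \<notin> bad (E k) n" using s Z(2) by blast
      then obtain d where d: "d > 0" "\<And>x y. s - d < x \<and> x \<le> s \<and> s < y \<and> y < s + d \<Longrightarrow>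
           emeasure N {x..<y} \<le> ennreal (E k * (g y - g x))"
        using s n unfolding bad_def by (force simp: not_less)
      show "\<exists>d>0. \<forall>x y. s - d < x \<and> x \<le> s \<and> s < y \<and> y < s + d \<longrightarrow>
           emeasure N {x..<y} \<le> ennreal (e * (g y - g x))"
      proof (intro exI[of _ d] conjI allI impI d(1))
        fix x y assume xy: "s - d < x \<and> x \<le> s \<and> s < y \<and> y < s + d"
        then have "E k * (g y - g x) \<le> e * (g y - g x)"
          using k mono_g[of x y] by (intro mult_right_mono) auto
        then show "emeasure N {x..<y} \<le> ennreal (e * (g y - g x))"
          using d(2)[OF xy] by (meson ennreal_leI order_trans)
      qed
    qed
  qed
qed

end

text \<open>\<open>ennreal\<close> truncates at 0, so the first summand on the right is the positive
  part of \<open>a - q\<close>.\<close>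

lemma ennreal_le_diff_add: "0 \<le> q \<Longrightarrow> ennreal a \<le> ennreal (a - q) + ennreal q"
  by (cases "a \<le> q") (auto simp: ennreal_plus[symmetric] ennreal_neg ennreal_leI simp del: ennreal_plus)

section \<open>Lebesgue points with respect to a Stieltjes measure\<close>

context derivator_on_line begin

abbreviation locally_integrable :: "(real \<Rightarrow> 'b::{banach, second_countable_topology}) \<Rightarrow> bool" where
  "locally_integrable \<phi> \<equiv> (\<forall>x y. set_integrable (ls_measure g) {x..<y} \<phi>)"

lemma set_integrable_const_Ico: "set_integrable (ls_measure g) {x..<y} (\<lambda>_. c :: 'b::{banach, second_countable_topology})"
  using emeasure_Ico_finite unfolding set_integrable_def
  by (intro integrable_scaleR_left integrable_real_indicator) auto

lemma set_integral_const_Ico: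
  "x \<le> y \<Longrightarrow> (LINT s:{x..<y}|ls_measure g. c) = (g y - g x) *\<^sub>R (c :: 'b::{banach, second_countable_topology})"
  using emeasure_Ico_finite measure_Ico unfolding set_lebesgue_integral_def
  by (subst integral_scaleR_left) (auto simp: less_top)

text \<open>The points where \<open>\<phi>\<close> is within \<open>q\<close> of \<open>c\<close>
  form a null set for the measure whose density is the excess of \<open>norm (\<phi> s - c)\<close>
  over \<open>q\<close>. Near almost every such point the excess is therefore negligible, and
  countably many pairs of \<open>c\<close> and \<open>q\<close> suffice.\<close>

lemma AE_Lebesgue_point:
  fixes \<phi> :: "real \<Rightarrow> 'b::{banach, second_countable_topology}"
  assumes borel [measurable]: "\<phi> \<in> borel_measurable borel" and int: "locally_integrable \<phi>"
  shows "AE s in ls_measure g. \<forall>e>0. \<exists>d>0. \<forall>x y. s - d < x \<and> x \<le> s \<and> s < y \<and> y < s + d \<longrightarrow>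
           norm ((LINT r:{x..<y}|ls_measure g. \<phi> r) - (g y - g x) *\<^sub>R \<phi> s) \<le> e * (g y - g x)"
proof -
  obtain D :: "'b set" where D: "countable D" "\<And>X. open X \<Longrightarrow> X \<noteq> {} \<Longrightarrow> \<exists>d\<in>D. d \<in> X"
    using countable_dense_exists by blast
  define N where "N c q = density (ls_measure g) (\<lambda>s. ennreal (norm (\<phi> s - c) - q))" for c q
  have em: "emeasure (N c q) A = (\<integral>\<^sup>+s\<in>A. ennreal (norm (\<phi> s - c) - q) \<partial>ls_measure g)"
    if "A \<in> sets borel" for A c q
    using that unfolding N_def by (subst emeasure_density) auto
  have fin: "emeasure (N c q) {- real n<..<real n} < \<infinity>" if "q > 0" for c q n
  proof -
    have "set_integrable (ls_measure g) {- real n..<real n} (\<lambda>s. \<phi> s - c)"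
      using int set_integrable_const_Ico by (intro set_integral_diff) auto
    then have "(\<integral>\<^sup>+s. ennreal (norm (indicator {- real n..<real n} s *\<^sub>R (\<phi> s - c))) \<partial>ls_measure g) < \<infinity>"
      by (auto simp: set_integrable_def integrable_iff_bounded)
    moreover have "emeasure (N c q) {- real n<..<real n} \<le>
        (\<integral>\<^sup>+s. ennreal (norm (indicator {- real n..<real n} s *\<^sub>R (\<phi> s - c))) \<partial>ls_measure g)"
      using that by (subst em) (auto intro!: nn_integral_mono ennreal_leI simp: indicator_def)
    ultimately show ?thesis by (rule order.strict_trans1[rotated])
  qed
  have "AE s in ls_measure g. \<forall>c\<in>D. \<forall>q\<in>(\<rat> \<inter> {0<..} :: real set). norm (\<phi> s - c) \<le> q \<longrightarrow>
      (\<forall>e>0. \<exists>d>0. \<forall>x y. s - d < x \<and> x \<le> s \<and> s < y \<and> y < s + d \<longrightarrow>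
           emeasure (N c q) {x..<y} \<le> ennreal (e * (g y - g x)))"
  proof (subst AE_ball_countable[OF D(1)], intro ballI, subst AE_ball_countable, intro countable_Int1 countable_rat, intro ballI)
    fix c and q :: real assume q: "q \<in> \<rat> \<inter> {0<..}"
    have meas: "{s. norm (\<phi> s - c) \<le> q} \<in> sets borel" by measurable
    have "emeasure (N c q) {s. norm (\<phi> s - c) \<le> q} = (\<integral>\<^sup>+s. 0 \<partial>ls_measure g)"
      unfolding em[OF meas] by (intro nn_integral_cong) (auto simp: indicator_def ennreal_neg)
    then have "{s. norm (\<phi> s - c) \<le> q} \<in> null_sets (N c q)"
      using meas by (auto simp: null_sets_def N_def)
    from AE_measure_ratio_tendsto_0[OF _ _ this]
    show "AE s in ls_measure g. norm (\<phi> s - c) \<le> q \<longrightarrow>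
      (\<forall>e>0. \<exists>d>0. \<forall>x y. s - d < x \<and> x \<le> s \<and> s < y \<and> y < s + d \<longrightarrow>
           emeasure (N c q) {x..<y} \<le> ennreal (e * (g y - g x)))"
      using fin q by (auto simp: N_def)
  qed
  then show ?thesis
  proof (eventually_elim, intro allI impI)
    fix s and e :: real
    assume *: "\<forall>c\<in>D. \<forall>q\<in>(\<rat> \<inter> {0<..} :: real set). norm (\<phi> s - c) \<le> q \<longrightarrow>
      (\<forall>e>0. \<exists>d>0. \<forall>x y. s - d < x \<and> x \<le> s \<and> s < y \<and> y < s + d \<longrightarrow>
           emeasure (N c q) {x..<y} \<le> ennreal (e * (g y - g x)))" and "e > 0"
    \<comment> \<open>The error \<open>e\<close> is shared out: \<open>e / 4\<close> for the
      integrated excess, \<open>q < e / 2\<close> for the cutoff and \<open>e / 4\<close> for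
      replacing \<open>c\<close> by \<open>\<phi> s\<close>. Since \<open>q > e / 4\<close>, the
      point \<open>s\<close> lies in the null set belonging to \<open>c\<close> and
      \<open>q\<close>.\<close>
    obtain c where c: "c \<in> D" "norm (\<phi> s - c) < e / 4"
      using D(2)[of "ball (\<phi> s) (e / 4)"] \<open>e > 0\<close> by (auto simp: dist_norm)
    obtain q where q: "q \<in> \<rat>" "e / 4 < q" "q < e / 2"
      using Rats_dense_in_real[of "e / 4" "e / 2"] \<open>e > 0\<close> by auto
    have "q > 0" using q \<open>e > 0\<close> by linarith
    then obtain d where d: "d > 0" and le: "\<And>x y. s - d < x \<and> x \<le> s \<and> s < y \<and> y < s + d \<Longrightarrow>
           emeasure (N c q) {x..<y} \<le> ennreal (e / 4 * (g y - g x))"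
      using *[rule_format, of c q "e / 4"] c q \<open>e > 0\<close> by auto
    show "\<exists>d>0. \<forall>x y. s - d < x \<and> x \<le> s \<and> s < y \<and> y < s + d \<longrightarrow>
           norm ((LINT r:{x..<y}|ls_measure g. \<phi> r) - (g y - g x) *\<^sub>R \<phi> s) \<le> e * (g y - g x)"
    proof (intro exI[of _ d] conjI d allI impI)
      fix x y assume xy: "s - d < x \<and> x \<le> s \<and> s < y \<and> y < s + d"
      let ?G = "g y - g x"
      have G: "?G \<ge> 0" using mono_g[of x y] xy by auto
      have "(LINT r:{x..<y}|ls_measure g. \<phi> r) - ?G *\<^sub>R \<phi> s = (LINT r:{x..<y}|ls_measure g. \<phi> r - \<phi> s)"
        using xy int by (subst set_integral_diff(2)) (auto simp: set_integral_const_Ico set_integrable_const_Ico)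
      also have "ennreal (norm \<dots>) \<le> (\<integral>\<^sup>+r. norm (indicator {x..<y} r *\<^sub>R (\<phi> r - \<phi> s)) \<partial>ls_measure g)"
        unfolding set_lebesgue_integral_def using int set_integrable_const_Ico
        by (intro integral_norm_bound_ennreal)
          (auto simp: set_integrable_def[symmetric] intro!: set_integral_diff(1))
      also have "\<dots> \<le> (\<integral>\<^sup>+r. ennreal (norm (\<phi> r - c) - q) * indicator {x..<y} r
            + ennreal (q + e / 4) * indicator {x..<y} r \<partial>ls_measure g)"
      proof (intro nn_integral_mono)
        fix r
        have "norm (\<phi> r - \<phi> s) \<le> norm (\<phi> r - c) + e / 4"
          using c(2) norm_triangle_ineq4[of "\<phi> r - c" "\<phi> s - c"] by simp
        then have "ennreal (norm (\<phi> r - \<phi> s)) \<le> ennreal (norm (\<phi> r - c) + e / 4)"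
          by (rule ennreal_leI)
        also have "\<dots> \<le> ennreal (norm (\<phi> r - c) + e / 4 - (q + e / 4)) + ennreal (q + e / 4)"
          using \<open>q > 0\<close> \<open>e > 0\<close> by (intro ennreal_le_diff_add) auto
        finally show "ennreal (norm (indicator {x..<y} r *\<^sub>R (\<phi> r - \<phi> s))) \<le>
            ennreal (norm (\<phi> r - c) - q) * indicator {x..<y} r + ennreal (q + e / 4) * indicator {x..<y} r"
          by (auto simp: indicator_def)
      qed
      also have "\<dots> = emeasure (N c q) {x..<y} + ennreal (q + e / 4) * ennreal ?G"
        using xy by (subst nn_integral_add) (auto simp: em emeasure_Ico nn_integral_cmult_indicator)
      also have "\<dots> \<le> ennreal (e / 4 * ?G) + ennreal (q + e / 4) * ennreal ?G"
        using le[OF xy] by (intro add_right_mono)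
      also have "\<dots> = ennreal ((e / 4 + (q + e / 4)) * ?G)"
        using \<open>q > 0\<close> \<open>e > 0\<close> G by (simp add: ennreal_mult[symmetric] ennreal_plus[symmetric] distrib_right del: ennreal_plus)
      also have "\<dots> \<le> ennreal (e * ?G)"
        using q G by (intro ennreal_leI mult_right_mono) auto
      finally show "norm ((LINT r:{x..<y}|ls_measure g. \<phi> r) - ?G *\<^sub>R \<phi> s) \<le> e * ?G"
        using G \<open>e > 0\<close> by (simp add: ennreal_le_iff)
    qed
  qed
qed

text \<open>\<open>jump\<close> is defined through \<open>Lim\<close>, so the right limit must first
  be shown to exist; by monotonicity it is the infimum of the values further right.\<close>

lemma g_tendsto_right: "(g \<longlongrightarrow> g x + jump g x) (at_right x)"
  and jump_le: "x < y \<Longrightarrow> jump g x \<le> g y - g x"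
  and jump_nonneg: "jump g x \<ge> 0"
proof -
  define L where "L = (INF y\<in>{x<..}. g y)"
  have bdd: "bdd_below (g ` {x<..})"
    using mono_g by (intro bdd_belowI[of _ "g x"]) auto
  have L_le: "L \<le> g y" if "x < y" for y
    unfolding L_def using bdd that by (intro cINF_lower) auto
  have lim: "(g \<longlongrightarrow> L) (at_right x)"
  proof (rule order_tendstoI)
    fix a assume "a < L"
    then show "\<forall>\<^sub>F y in at_right x. a < g y"
      by (intro eventually_at_rightI[of x "x + 1"]) (auto intro: order.strict_trans2 L_le)
  next
    fix a assume "L < a"
    then obtain y where "x < y" "g y < a"
      using cINF_less_iff[of "{x<..}" g a] bdd by (auto simp: L_def gt_ex)
    then show "\<forall>\<^sub>F y in at_right x. g y < a"
      by (intro eventually_at_rightI[of x y]) (auto intro: le_less_trans[OF mono_g[OF less_imp_le]])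
  qed
  then have "jump g x = L - g x"
    by (simp add: jump_def tendsto_Lim)
  then show "(g \<longlongrightarrow> g x + jump g x) (at_right x)" "x < y \<Longrightarrow> jump g x \<le> g y - g x"
    using lim L_le by auto
  have "g x \<le> L" unfolding L_def by (intro cINF_greatest) (auto intro: mono_g gt_ex)
  then show "jump g x \<ge> 0" using \<open>jump g x = L - g x\<close> by simp
qed

text \<open>Rational endpoints make the cover countable: each point of the set lies in some
  \<open>{p..<q}\<close> of measure \<open>g q - g p = 0\<close>.\<close>

lemma AE_not_constancy_set: "AE s in ls_measure g. s \<notin> constancy_set g"
proof (rule AE_I')
  let ?Z = "\<Union>(p, q)\<in>{(p, q). p \<in> \<rat> \<and> q \<in> \<rat> \<and> p \<le> q \<and> g p = g q}. {p..<q}"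
  have "countable {(p, q). p \<in> \<rat> \<and> q \<in> \<rat> \<and> p \<le> q \<and> g p = g q}"
    by (rule countable_subset[of _ "\<rat> \<times> \<rat>"]) (auto simp: countable_rat)
  then show "?Z \<in> null_sets (ls_measure g)"
    by (intro null_sets_UN') (auto simp: null_sets_def emeasure_Ico)
  show "{s \<in> space (ls_measure g). \<not> s \<notin> constancy_set g} \<subseteq> ?Z"
  proof
    fix s assume "s \<in> {s \<in> space (ls_measure g). \<not> s \<notin> constancy_set g}"
    then obtain U where U: "open U" "s \<in> U" "g constant_on U"
      by (auto simp: constancy_set_def)
    obtain d where d: "d > 0" "ball s d \<subseteq> U" using U openE by blast
    obtain p where p: "p \<in> \<rat>" "s - d < p" "p < s" using Rats_dense_in_real[of "s - d" s] d by auto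
    obtain q where q: "q \<in> \<rat>" "s < q" "q < s + d" using Rats_dense_in_real[of s "s + d"] d by auto
    have "p \<in> U" "q \<in> U" using d p q by (auto simp: subset_eq dist_real_def)
    then have "g p = g q" using U(3) by (auto simp: constant_on_def)
    then show "s \<in> ?Z" using p q by (intro UN_I[of "(p, q)"]) auto
  qed
qed

text \<open>Uniqueness is what allows the description \<open>g_deriv\<close> to be evaluated. It
  amounts to the limit filter being proper: a jump makes \<open>g r \<noteq> g s\<close> for all
  \<open>r > s\<close>, and otherwise points with \<open>g r \<noteq> g s\<close> accumulate at
  \<open>s\<close> because \<open>g\<close> is constant on no neighbourhood of it.\<close>

lemma has_g_deriv_unique:
  assumes "s \<notin> constancy_set g" "has_g_deriv g F d s" "has_g_deriv g F d' s"
  shows "d = d'"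
proof (cases "s \<in> jump_set g")
  case True
  have "s islimpt {r. s < r \<and> g r \<noteq> g s}"
  proof (rule islimptI)
    fix T :: "real set" assume "s \<in> T" "open T"
    then obtain e where e: "e > 0" "ball s e \<subseteq> T" using openE by blast
    have "g s < g (s + e / 2)" using jump_le[of s "s + e / 2"] e(1) True by (auto simp: jump_set_def)
    then show "\<exists>y\<in>{r. s < r \<and> g r \<noteq> g s}. y \<in> T \<and> y \<noteq> s"
      using e by (intro bexI[of _ "s + e / 2"]) (auto simp: subset_eq dist_real_def)
  qed
  then have "at s within {r. s < r \<and> g r \<noteq> g s} \<noteq> bot" by (simp add: trivial_limit_within)
  from tendsto_unique[OF this] show ?thesis
    using assms True by (auto simp: has_g_deriv_def)
next
  case False
  have "s islimpt {r. g r \<noteq> g s}"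
  proof (rule islimptI)
    fix T :: "real set" assume "s \<in> T" "open T"
    show "\<exists>y\<in>{r. g r \<noteq> g s}. y \<in> T \<and> y \<noteq> s"
    proof (rule ccontr)
      assume "\<not> ?thesis"
      then have "g constant_on T" by (auto simp: constant_on_def)
      then show False using assms(1) \<open>s \<in> T\<close> \<open>open T\<close> by (auto simp: constancy_set_def)
    qed
  qed
  then have "at s within {r. g r \<noteq> g s} \<noteq> bot" by (simp add: trivial_limit_within)
  from tendsto_unique[OF this] show ?thesis
    using assms False by (auto simp: has_g_deriv_def)
qed

text \<open>An indefinite integral together with a chosen Borel density. Fixing the density at every
  point makes it possible to compute with it pointwise, which the derivative does not
  permit.\<close>

definition g_primitive :: "(real \<Rightarrow> 'b::{banach, second_countable_topology}) \<Rightarrow> (real \<Rightarrow> 'b) \<Rightarrow> bool" where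
  "g_primitive F \<phi> \<longleftrightarrow> \<phi> \<in> borel_measurable borel \<and> locally_integrable \<phi> \<and>
     (\<forall>x y. x \<le> y \<longrightarrow> (LINT s:{x..<y}|ls_measure g. \<phi> s) = F y - F x)"

text \<open>At a Lebesgue point the bound over \<open>{s..<r}\<close> gives the quotients from the
  right, which is all that the derivative at a jump asks for. Quotients from the left need the bound
  over \<open>{r..<s}\<close>, obtained at the other points, where \<open>g\<close> is
  continuous.\<close>

theorem g_deriv_g_primitive:
  assumes "g_primitive F \<phi>"
  shows "AE s in ls_measure g. g_deriv g F s = \<phi> s"
proof -
  have F: "(LINT s:{x..<y}|ls_measure g. \<phi> s) = F y - F x" if "x \<le> y" for x y
    using assms that by (simp add: g_primitive_def)
  have "AE s in ls_measure g. \<forall>e>0. \<exists>d>0. \<forall>x y. s - d < x \<and> x \<le> s \<and> s < y \<and> y < s + d \<longrightarrow>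
           norm ((LINT r:{x..<y}|ls_measure g. \<phi> r) - (g y - g x) *\<^sub>R \<phi> s) \<le> e * (g y - g x)"
    using assms by (intro AE_Lebesgue_point) (auto simp: g_primitive_def)
  with AE_not_constancy_set show ?thesis
  proof eventually_elim
    case (elim s)
    have quotient_le: "dist ((F r - F q) /\<^sub>R (g r - g q)) (\<phi> s) \<le> e"
      if "norm (F r - F q - (g r - g q) *\<^sub>R \<phi> s) \<le> e * (g r - g q)" "q < r" "g r \<noteq> g q" for r q e
    proof -
      have G: "g r - g q > 0" using that mono_g[of q r] by auto
      have "(F r - F q) /\<^sub>R (g r - g q) - \<phi> s = (F r - F q - (g r - g q) *\<^sub>R \<phi> s) /\<^sub>R (g r - g q)"
        using G by (simp add: scaleR_right_diff_distrib)
      then have "dist ((F r - F q) /\<^sub>R (g r - g q)) (\<phi> s) = norm (F r - F q - (g r - g q) *\<^sub>R \<phi> s) / (g r - g q)"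
        using G by (simp add: dist_norm divide_inverse mult.commute)
      also have "\<dots> \<le> e" using that G by (simp add: divide_le_eq)
      finally show ?thesis .
    qed
    have est: "\<exists>d>0. (\<forall>r. s < r \<and> r < s + d \<and> g r \<noteq> g s \<longrightarrow> dist ((F r - F s) /\<^sub>R (g r - g s)) (\<phi> s) < e) \<and>
        (s \<notin> jump_set g \<longrightarrow>
          (\<forall>r. s - d < r \<and> r < s \<and> g r \<noteq> g s \<longrightarrow> dist ((F r - F s) /\<^sub>R (g r - g s)) (\<phi> s) < e))"
      if "e > 0" for e
    proof -
      obtain d where d: "d > 0" and le: "\<And>x y. s - d < x \<Longrightarrow> x \<le> s \<Longrightarrow> s < y \<Longrightarrow> y < s + d \<Longrightarrow>
           norm (F y - F x - (g y - g x) *\<^sub>R \<phi> s) \<le> e / 2 * (g y - g x)"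
        using elim(2)[rule_format, of "e / 2"] F \<open>e > 0\<close> by auto
      have right: "dist ((F r - F s) /\<^sub>R (g r - g s)) (\<phi> s) < e" if "s < r" "r < s + d" "g r \<noteq> g s" for r
        using quotient_le[of r s "e / 2"] le[of s r] that d \<open>e > 0\<close> by auto
      have left: "dist ((F r - F s) /\<^sub>R (g r - g s)) (\<phi> s) < e"
        if r: "s - d < r" "r < s" "g r \<noteq> g s" and "s \<notin> jump_set g" for r
      proof -
        have "jump g s = 0" using that jump_nonneg[of s] by (simp add: jump_set_def)
        then have lim: "(g \<longlongrightarrow> g s) (at_right s)" using g_tendsto_right[of s] by simp
        \<comment> \<open>The Lebesgue bound requires \<open>s < y\<close>, so
          \<open>{r..<s}\<close> is reached by subtracting \<open>{s..<y}\<close> from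
          \<open>{r..<y}\<close> and letting \<open>y\<close> decrease to \<open>s\<close>;
          continuity of \<open>g\<close> at \<open>s\<close> removes the extra term.\<close>
        have "norm (F s - F r - (g s - g r) *\<^sub>R \<phi> s) \<le> e / 2 * (g s - g r) + e / 2 * (g s - g s)"
        proof (rule tendsto_lowerbound)
          show "((\<lambda>y. e / 2 * (g y - g r) + e / 2 * (g y - g s)) \<longlongrightarrow>
              e / 2 * (g s - g r) + e / 2 * (g s - g s)) (at_right s)"
            by (intro tendsto_intros lim)
          show "\<forall>\<^sub>F y in at_right s. norm (F s - F r - (g s - g r) *\<^sub>R \<phi> s) \<le> e / 2 * (g y - g r) + e / 2 * (g y - g s)"
          proof (rule eventually_at_rightI)
            fix y assume y: "y \<in> {s<..<s + d}"
            have "F s - F r - (g s - g r) *\<^sub>R \<phi> s =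
              (F y - F r - (g y - g r) *\<^sub>R \<phi> s) - (F y - F s - (g y - g s) *\<^sub>R \<phi> s)"
              by (simp add: algebra_simps)
            also have "norm \<dots> \<le> e / 2 * (g y - g r) + e / 2 * (g y - g s)"
              using le[of r y] le[of s y] r y d
              by (intro order_trans[OF norm_triangle_ineq4[of "F y - F r - (g y - g r) *\<^sub>R \<phi> s"]] add_mono) auto
            finally show "norm (F s - F r - (g s - g r) *\<^sub>R \<phi> s) \<le> e / 2 * (g y - g r) + e / 2 * (g y - g s)" .
          qed (use d in auto)
        qed auto
        then have "dist ((F s - F r) /\<^sub>R (g s - g r)) (\<phi> s) \<le> e / 2"
          using r by (intro quotient_le) auto
        moreover have "(F s - F r) /\<^sub>R (g s - g r) = (F r - F s) /\<^sub>R (g r - g s)"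
          by (metis inverse_minus_eq minus_diff_eq scaleR_minus_left scaleR_minus_right)
        ultimately show ?thesis using \<open>e > 0\<close> by auto
      qed
      show ?thesis using d left right by blast
    qed
    have "has_g_deriv g F (\<phi> s) s"
    proof (cases "s \<in> jump_set g")
      case True
      have "((\<lambda>r. (F r - F s) /\<^sub>R (g r - g s)) \<longlongrightarrow> \<phi> s) (at s within {r. s < r \<and> g r \<noteq> g s})"
        unfolding tendsto_iff eventually_at
      proof (intro allI impI)
        fix e :: real assume "e > 0"
        from est[OF this] show "\<exists>d>0. \<forall>r\<in>{r. s < r \<and> g r \<noteq> g s}. r \<noteq> s \<and> dist r s < d \<longrightarrow>
            dist ((F r - F s) /\<^sub>R (g r - g s)) (\<phi> s) < e"
          by (auto simp: dist_real_def abs_less_iff)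
      qed
      then show ?thesis using True elim by (simp add: has_g_deriv_def)
    next
      case False
      have "((\<lambda>r. (F r - F s) /\<^sub>R (g r - g s)) \<longlongrightarrow> \<phi> s) (at s within {r. g r \<noteq> g s})"
        unfolding tendsto_iff eventually_at
      proof (intro allI impI)
        fix e :: real assume "e > 0"
        from est[OF this] False obtain d where d: "d > 0"
          "\<And>r. s < r \<Longrightarrow> r < s + d \<Longrightarrow> g r \<noteq> g s \<Longrightarrow> dist ((F r - F s) /\<^sub>R (g r - g s)) (\<phi> s) < e"
          "\<And>r. s - d < r \<Longrightarrow> r < s \<Longrightarrow> g r \<noteq> g s \<Longrightarrow> dist ((F r - F s) /\<^sub>R (g r - g s)) (\<phi> s) < e"
          by blast
        show "\<exists>d>0. \<forall>r\<in>{r. g r \<noteq> g s}. r \<noteq> s \<and> dist r s < d \<longrightarrow>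
            dist ((F r - F s) /\<^sub>R (g r - g s)) (\<phi> s) < e"
          using d by (intro exI[of _ d]) (auto simp: dist_real_def abs_less_iff neq_iff)
      qed
      then show ?thesis using False elim by (simp add: has_g_deriv_def)
    qed
    then show ?case
      unfolding g_deriv_def using has_g_deriv_unique[OF elim(1)] by (intro the_equality) auto
  qed
qed


section \<open>Integration by parts\<close>

lemma g_primitiveD:
  assumes "g_primitive F \<phi>"
  shows "\<phi> \<in> borel_measurable borel" "set_integrable (ls_measure g) {x..<y} \<phi>"
    "x \<le> y \<Longrightarrow> (LINT s:{x..<y}|ls_measure g. \<phi> s) = F y - F x"
  using assms by (auto simp: g_primitive_def)

lemma measure_singleton: "measure (ls_measure g) {s} = jump g s"
proof -
  let ?A = "\<lambda>n::nat. {s..<s + 1 / real (Suc n)}"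
  have "(\<lambda>n. measure (ls_measure g) (?A n)) \<longlonglongrightarrow> measure (ls_measure g) (\<Inter>n. ?A n)"
  proof (rule Lim_measure_decseq)
    show "decseq ?A"
    proof (rule decseq_SucI)
      fix n
      have "1 / real (Suc (Suc n)) \<le> 1 / real (Suc n)" by (simp add: frac_le)
      then show "?A (Suc n) \<subseteq> ?A n" by (simp only: ivl_subset) linarith
    qed
    show "emeasure (ls_measure g) (?A n) \<noteq> \<infinity>" for n
      using emeasure_Ico_finite[of s "s + 1 / real (Suc n)"] by simp
    show "range ?A \<subseteq> sets (ls_measure g)" by (simp add: image_subset_iff)
  qed
  moreover have "(\<Inter>n. ?A n) = {s}"
  proof (intro equalityI subsetI)
    fix r assume r: "r \<in> (\<Inter>n. ?A n)"
    have "r \<le> s"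
    proof (rule ccontr)
      assume "\<not> r \<le> s"
      then obtain n where "1 / real (Suc n) < r - s" using nat_approx_posE[of "r - s"] by auto
      moreover have "r \<in> ?A n" using r by (rule INT_D) simp
      ultimately show False by simp
    qed
    moreover have "r \<in> ?A 0" using r by (rule INT_D) simp
    ultimately show "r \<in> {s}" by simp
  qed auto
  moreover have "measure (ls_measure g) (?A n) = g (s + 1 / real (Suc n)) - g s" for n
    by (intro measure_Ico) auto
  moreover have "(\<lambda>n. g (s + 1 / real (Suc n)) - g s) \<longlonglongrightarrow> g s + jump g s - g s"
  proof (intro tendsto_intros filterlim_compose[OF g_tendsto_right])
    have "(\<lambda>n. s + 1 / real (Suc n)) \<longlonglongrightarrow> s + 0"
      by (intro tendsto_intros LIMSEQ_Suc[OF lim_1_over_n])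
    then show "filterlim (\<lambda>n. s + 1 / real (Suc n)) (at_right s) sequentially"
      by (auto simp: filterlim_at)
  qed
  ultimately have "(\<lambda>n. g (s + 1 / real (Suc n)) - g s) \<longlonglongrightarrow> measure (ls_measure g) {s}"
      "(\<lambda>n. g (s + 1 / real (Suc n)) - g s) \<longlonglongrightarrow> jump g s"
    by (simp_all only: add_diff_cancel_left')
  then show ?thesis by (rule LIMSEQ_unique)
qed

text \<open>The right end \<open>s\<close> carries mass \<open>jump g s\<close>. Up to
  \<open>G x\<close> the value is the right limit of \<open>G\<close> at \<open>s\<close>, the
  source of the jump term in the product rule.\<close>

lemma set_integral_Icc_eq:
  assumes "g_primitive G \<psi>" "x \<le> s"
  shows "set_integrable (ls_measure g) {x..s} \<psi>"
    "(LINT r:{x..s}|ls_measure g. \<psi> r) = G s - G x + jump g s *\<^sub>R \<psi> s"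
proof -
  have [measurable]: "\<psi> \<in> borel_measurable borel" using assms g_primitiveD by auto
  have int: "set_integrable (ls_measure g) {x..<s} \<psi>" "set_integrable (ls_measure g) {s} \<psi>"
    using g_primitiveD(2)[OF assms(1)] set_integrable_subset[OF g_primitiveD(2)[OF assms(1), of s "s + 1"], of "{s}"]
    by simp_all
  have eq: "{x..s} = {x..<s} \<union> {s}" using assms(2) by auto
  show "set_integrable (ls_measure g) {x..s} \<psi>"
    unfolding eq using int by (intro set_integrable_Un) auto
  have "(LINT r:{x..s}|ls_measure g. \<psi> r) = (LINT r:{x..<s}|ls_measure g. \<psi> r) + (LINT r:{s}|ls_measure g. \<psi> r)"
    unfolding eq using int by (intro set_integral_Un) auto
  also have "(LINT r:{s}|ls_measure g. \<psi> r) = (LINT r:{s}|ls_measure g. \<psi> s)"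
    unfolding set_lebesgue_integral_def by (intro Bochner_Integration.integral_cong) (auto simp: indicator_def)
  also have "\<dots> = jump g s *\<^sub>R \<psi> s"
  proof -
    have "emeasure (ls_measure g) {s} \<le> emeasure (ls_measure g) {s..<s+1}" by (intro emeasure_mono) auto
    then have "emeasure (ls_measure g) {s} < \<infinity>" using emeasure_Ico_finite by (rule order.strict_trans1)
    then show ?thesis unfolding set_lebesgue_integral_def
      by (subst integral_scaleR_left) (auto simp: measure_singleton)
  qed
  finally show "(LINT r:{x..s}|ls_measure g. \<psi> r) = G s - G x + jump g s *\<^sub>R \<psi> s"
    using assms by (simp add: g_primitiveD(3))
qed

text \<open>As \<open>x\<close> varies, \<open>F x\<close> is an integral depending on a parameter,
  with a jointly measurable integrand. Two integrals, at most one of them nonzero, avoid a case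
  distinction on the sign of \<open>x\<close> in the formula.\<close>

lemma g_primitive_borel_measurable:
  fixes F :: "real \<Rightarrow> 'b::{banach, second_countable_topology}"
  assumes "g_primitive F \<phi>"
  shows "F \<in> borel_measurable borel"
proof -
  have [measurable]: "\<phi> \<in> borel_measurable borel" using assms by (rule g_primitiveD)
  have "F x = F 0 + (\<integral>r. (if 0 \<le> r \<and> r < x then \<phi> r else 0) \<partial>ls_measure g)
      - (\<integral>r. (if x \<le> r \<and> r < 0 then \<phi> r else 0) \<partial>ls_measure g)" for x
  proof -
    have ind: "(\<integral>r. (if p \<le> r \<and> r < q then \<phi> r else 0) \<partial>ls_measure g) = (LINT r:{p..<q}|ls_measure g. \<phi> r)" for p q
      unfolding set_lebesgue_integral_def by (intro Bochner_Integration.integral_cong) auto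
    show ?thesis unfolding ind
      using g_primitiveD(3)[OF assms, of 0 x] g_primitiveD(3)[OF assms, of x 0]
      by (cases "0 \<le> x") (auto simp: set_lebesgue_integral_def)
  qed
  then have "F = (\<lambda>x. F 0 + (\<integral>r. (if 0 \<le> r \<and> r < x then \<phi> r else 0) \<partial>ls_measure g)
      - (\<integral>r. (if x \<le> r \<and> r < 0 then \<phi> r else 0) \<partial>ls_measure g))"
    by blast
  also have "\<dots> \<in> borel_measurable borel" by measurable
  finally show ?thesis .
qed

lemma jump_borel_measurable [measurable]: "jump g \<in> borel_measurable borel"
proof (rule borel_measurable_LIMSEQ_real)
  have [measurable]: "g \<in> borel_measurable borel"
    by (rule borel_measurable_mono) (auto simp: mono_def mono_g)
  show "(\<lambda>s. g (s + 1 / real (Suc n)) - g s) \<in> borel_measurable borel" for n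
    by measurable
  show "(\<lambda>n. g (s + 1 / real (Suc n)) - g s) \<longlonglongrightarrow> jump g s" for s
  proof -
    have "(\<lambda>n. s + 1 / real (Suc n)) \<longlonglongrightarrow> s + 0"
      by (intro tendsto_intros LIMSEQ_Suc[OF lim_1_over_n])
    then have "filterlim (\<lambda>n. s + 1 / real (Suc n)) (at_right s) sequentially"
      by (auto simp: filterlim_at)
    from filterlim_compose[OF g_tendsto_right this]
    have "(\<lambda>n. g (s + 1 / real (Suc n)) - g s) \<longlonglongrightarrow> g s + jump g s - g s"
      by (intro tendsto_intros)
    then show ?thesis by simp
  qed
qed

text \<open>
  Fubini on the square \<open>[x, y) \<times> [x, y)\<close>, cut along its diagonal; the diagonal itself has
  positive mass at the jumps and contributes the term \<open>jump g s * \<psi> s\<close>.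
\<close>

lemma g_primitive_mult:
  fixes F :: "real \<Rightarrow> 'b::{banach, second_countable_topology}" and G :: "real \<Rightarrow> real"
  assumes F: "g_primitive F \<phi>" and G: "g_primitive G \<psi>"
  shows "g_primitive (\<lambda>s. G s *\<^sub>R F s) (\<lambda>s. (G s + jump g s * \<psi> s) *\<^sub>R \<phi> s + \<psi> s *\<^sub>R F s)"
proof -
  let ?M = "ls_measure g"
  interpret pair_sigma_finite ?M ?M ..
  note [measurable] = g_primitive_borel_measurable[OF F] g_primitive_borel_measurable[OF G]
    g_primitiveD(1)[OF F] g_primitiveD(1)[OF G]
  define H where "H = (\<lambda>s. (G s + jump g s * \<psi> s) *\<^sub>R \<phi> s + \<psi> s *\<^sub>R F s)"
  have main: "set_integrable ?M {x..<y} H \<and> (LINT s:{x..<y}|?M. H s) = G y *\<^sub>R F y - G x *\<^sub>R F x"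
    if "x \<le> y" for x y
  proof -
    define \<Phi> where "\<Phi> s = indicator {x..<y} s *\<^sub>R \<phi> s" for s
    define \<Psi> where "\<Psi> s = indicator {x..<y} s *\<^sub>R \<psi> s" for s
    have int: "integrable ?M \<Phi>" "integrable ?M \<Psi>"
      using g_primitiveD(2)[OF F, of x y] g_primitiveD(2)[OF G, of x y]
      unfolding \<Phi>_def \<Psi>_def set_integrable_def by simp_all
    have total: "integral\<^sup>L ?M \<Phi> = F y - F x" "integral\<^sup>L ?M \<Psi> = G y - G x"
      using g_primitiveD(3)[OF F that] g_primitiveD(3)[OF G that]
      unfolding \<Phi>_def \<Psi>_def set_lebesgue_integral_def by simp_all
    have [measurable]: "\<Phi> \<in> borel_measurable borel" "\<Psi> \<in> borel_measurable borel"
      unfolding \<Phi>_def \<Psi>_def by measurable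
    have h: "integrable (?M \<Otimes>\<^sub>M ?M) (\<lambda>(s, r). \<Psi> r *\<^sub>R \<Phi> s)"
    proof (rule Fubini_integrable)
      show "integrable ?M (\<lambda>s. \<integral>r. norm (case (s, r) of (s, r) \<Rightarrow> \<Psi> r *\<^sub>R \<Phi> s) \<partial>?M)"
        using int by (simp add: integrable_norm)
    qed (use int in auto)
    have h': "integrable (?M \<Otimes>\<^sub>M ?M) (\<lambda>(s, r). (if s < r then \<Psi> r else 0) *\<^sub>R \<Phi> s)"
      by (rule Bochner_Integration.integrable_bound[OF h]) auto
    \<comment> \<open>\<open>a\<close> collects the part \<open>r \<le> s\<close> including the
      diagonal, \<open>b\<close> the part \<open>s < r\<close>. As \<open>b\<close> is strict,
      swapping its double integral yields inner integrals over \<open>{x..<r}\<close>, which are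
      increments of \<open>F\<close>.\<close>
    define a where "a s = (\<integral>r. (if r \<le> s then \<Psi> r else 0) \<partial>?M)" for s
    define b where "b s = (\<integral>r. (if s < r then \<Psi> r else 0) \<partial>?M)" for s
    have int_a: "integrable ?M (\<lambda>r. if r \<le> s then \<Psi> r else 0)" for s
      by (rule Bochner_Integration.integrable_bound[OF int(2)]) auto
    have int_b: "integrable ?M (\<lambda>r. if s < r then \<Psi> r else 0)" for s
      by (rule Bochner_Integration.integrable_bound[OF int(2)]) auto
    have ab: "a s + b s = G y - G x" for s
    proof -
      have "a s + b s = (\<integral>r. (if r \<le> s then \<Psi> r else 0) + (if s < r then \<Psi> r else 0) \<partial>?M)"
        unfolding a_def b_def using int_a int_b by simp
      also have "\<dots> = integral\<^sup>L ?M \<Psi>" by (intro Bochner_Integration.integral_cong) auto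
      finally show ?thesis using total by simp
    qed
    have bPhi: "b s *\<^sub>R \<Phi> s = (\<integral>r. (if s < r then \<Psi> r else 0) *\<^sub>R \<Phi> s \<partial>?M)" for s
      unfolding b_def using int_b by (subst integral_scaleR_left) auto
    have int_bPhi: "integrable ?M (\<lambda>s. b s *\<^sub>R \<Phi> s)"
      unfolding bPhi using integrable_fst'[OF h'] by simp
    have int_aPhi: "integrable ?M (\<lambda>s. a s *\<^sub>R \<Phi> s)"
    proof -
      have "integrable ?M (\<lambda>s. (G y - G x) *\<^sub>R \<Phi> s - b s *\<^sub>R \<Phi> s)"
        using int int_bPhi by auto
      moreover have "(G y - G x) *\<^sub>R \<Phi> s - b s *\<^sub>R \<Phi> s = a s *\<^sub>R \<Phi> s" for s
        by (simp add: ab[of s, symmetric] scaleR_left_distrib)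
      ultimately show ?thesis by simp
    qed
    have left: "a s *\<^sub>R \<Phi> s = indicator {x..<y} s *\<^sub>R ((G s + jump g s * \<psi> s) *\<^sub>R \<phi> s) - G x *\<^sub>R \<Phi> s" for s
    proof (cases "s \<in> {x..<y}")
      case True
      have "a s = (LINT r:{x..s}|?M. \<psi> r)"
        using True unfolding a_def \<Psi>_def set_lebesgue_integral_def
        by (intro Bochner_Integration.integral_cong) (auto simp: indicator_def)
      also have "\<dots> = G s - G x + jump g s * \<psi> s"
        using set_integral_Icc_eq(2)[OF G] True by simp
      finally have "G s + jump g s * \<psi> s = a s + G x" by simp
      then show ?thesis using True by (simp add: \<Phi>_def scaleR_left_distrib)
    qed (simp add: \<Phi>_def)
    have right: "(\<integral>s. (if s < r then \<Psi> r else 0) *\<^sub>R \<Phi> s \<partial>?M) = indicator {x..<y} r *\<^sub>R (\<psi> r *\<^sub>R F r) - \<Psi> r *\<^sub>R F x" for r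
    proof (cases "r \<in> {x..<y}")
      case True
      have "(\<integral>s. (if s < r then \<Psi> r else 0) *\<^sub>R \<Phi> s \<partial>?M) = (\<integral>s. \<psi> r *\<^sub>R (indicator {x..<r} s *\<^sub>R \<phi> s) \<partial>?M)"
        using True unfolding \<Phi>_def \<Psi>_def
        by (intro Bochner_Integration.integral_cong) (auto simp: indicator_def)
      also have "\<dots> = \<psi> r *\<^sub>R (F r - F x)"
        using True g_primitiveD(3)[OF F, of x r]
        by (subst integral_scaleR_right) (simp_all add: set_lebesgue_integral_def)
      finally show ?thesis using True by (simp add: \<Psi>_def algebra_simps)
    next
      case False
      then have "(if s < r then \<Psi> r else 0) = 0" "\<Psi> r = 0" for s by (auto simp: \<Psi>_def)
      then show ?thesis using False by simp
    qed
    have iA: "integrable ?M (\<lambda>s. indicator {x..<y} s *\<^sub>R ((G s + jump g s * \<psi> s) *\<^sub>R \<phi> s))"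
    proof -
      have "integrable ?M (\<lambda>s. a s *\<^sub>R \<Phi> s + G x *\<^sub>R \<Phi> s)" using int_aPhi int by auto
      then show ?thesis unfolding left by simp
    qed
    have iB: "integrable ?M (\<lambda>r. indicator {x..<y} r *\<^sub>R (\<psi> r *\<^sub>R F r))"
    proof -
      have "integrable ?M (\<lambda>r. \<integral>s. (if s < r then \<Psi> r else 0) *\<^sub>R \<Phi> s \<partial>?M)"
        using integrable_snd[OF h'] by simp
      then have "integrable ?M (\<lambda>r. (\<integral>s. (if s < r then \<Psi> r else 0) *\<^sub>R \<Phi> s \<partial>?M) + \<Psi> r *\<^sub>R F x)"
        using int by auto
      then show ?thesis unfolding right by simp
    qed
    \<comment> \<open>The product of the two increments is the integral over the whole square.
      Evaluating the two triangles and cancelling the terms with \<open>F x\<close> and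
      \<open>G x\<close> leaves the increment of the product.\<close>
    have "(G y - G x) *\<^sub>R (F y - F x) = (\<integral>s. (a s + b s) *\<^sub>R \<Phi> s \<partial>?M)"
      unfolding ab using int total by simp
    also have "\<dots> = (\<integral>s. a s *\<^sub>R \<Phi> s \<partial>?M) + (\<integral>s. b s *\<^sub>R \<Phi> s \<partial>?M)"
      using int_aPhi int_bPhi by (simp add: scaleR_left_distrib)
    also have "(\<integral>s. a s *\<^sub>R \<Phi> s \<partial>?M) = (\<integral>s. indicator {x..<y} s *\<^sub>R ((G s + jump g s * \<psi> s) *\<^sub>R \<phi> s) \<partial>?M) - G x *\<^sub>R (F y - F x)"
      unfolding left using iA int total by simp
    also have "(\<integral>s. b s *\<^sub>R \<Phi> s \<partial>?M) = (\<integral>r. (\<integral>s. (if s < r then \<Psi> r else 0) *\<^sub>R \<Phi> s \<partial>?M) \<partial>?M)"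
      unfolding bPhi using Fubini_integral[OF h'] by simp
    also have "\<dots> = (\<integral>r. indicator {x..<y} r *\<^sub>R (\<psi> r *\<^sub>R F r) \<partial>?M) - (G y - G x) *\<^sub>R F x"
      unfolding right using iB int total by simp
    finally have "(\<integral>s. indicator {x..<y} s *\<^sub>R ((G s + jump g s * \<psi> s) *\<^sub>R \<phi> s) \<partial>?M) +
        (\<integral>r. indicator {x..<y} r *\<^sub>R (\<psi> r *\<^sub>R F r) \<partial>?M) = G y *\<^sub>R F y - G x *\<^sub>R F x"
      by (simp add: algebra_simps)
    then show ?thesis
      using iA iB by (simp add: H_def set_integrable_def set_lebesgue_integral_def scaleR_right_distrib)
  qed
  show ?thesis
    unfolding g_primitive_def H_def[symmetric]
  proof (intro conjI allI impI)
    show "H \<in> borel_measurable borel" unfolding H_def by measurable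
    show "set_integrable ?M {x..<y} H" for x y
      using main[of x y] by (cases "x \<le> y") auto
  qed (use main in auto)
qed

lemma g_primitive_cmult:
  "g_primitive F \<phi> \<Longrightarrow> g_primitive (\<lambda>s. c *\<^sub>R F s) (\<lambda>s. c *\<^sub>R \<phi> s)"
  by (auto simp: g_primitive_def scaleR_right_diff_distrib[symmetric] intro!: set_integrable_scaleR_right)

lemma g_primitive_add:
  "g_primitive F \<phi> \<Longrightarrow> g_primitive G \<psi> \<Longrightarrow> g_primitive (\<lambda>s. F s + G s) (\<lambda>s. \<phi> s + \<psi> s)"
  by (auto simp: g_primitive_def set_integral_add)

lemma g_primitive_const: "g_primitive (\<lambda>s. c) (\<lambda>s. 0)"
  by (auto simp: g_primitive_def set_integrable_def)

lemma g_primitive_sum: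
  assumes "\<And>k. k \<in> A \<Longrightarrow> g_primitive (F k) (\<phi> k)"
  shows "g_primitive (\<lambda>s. \<Sum>k\<in>A. F k s) (\<lambda>s. \<Sum>k\<in>A. \<phi> k s)"
  using assms
  by (induction A rule: infinite_finite_induct) (auto intro!: g_primitive_add g_primitive_const)

text \<open>An almost-everywhere version \<open>\<phi>'\<close> of the density need not be Borel,
  but the completion makes it measurable. This is the passage from \<open>g_primitive\<close> to
  integrals of expressions in \<open>g_deriv\<close>.\<close>

lemma g_integral_g_primitive:
  fixes F :: "real \<Rightarrow> 'b::{banach, second_countable_topology}"
  assumes F: "g_primitive F \<phi>" and AE: "AE s in ls_measure g. \<phi>' s = \<phi> s"
  shows "g_integrable g x y \<phi>'" "g_integral g x y \<phi>' = F y - F x"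
proof -
  let ?C = "completion (ls_measure g)"
  note [measurable] = g_primitiveD(1)[OF F]
  have AE': "AE s in ?C. \<phi>' s = \<phi> s" using AE by (rule AE_completion)
  have \<phi>': "\<phi>' \<in> borel_measurable ?C"
  proof (rule measurableI)
    fix A :: "'b set" assume A: "A \<in> sets borel"
    have "\<phi> -` A \<inter> space (ls_measure g) \<in> sets (ls_measure g)"
      using A by measurable
    then have "\<phi> -` A \<in> sets ?C" by (simp add: sets_completionI_sets)
    moreover have "AE s in ?C. s \<in> \<phi> -` A \<longleftrightarrow> s \<in> \<phi>' -` A"
      using AE' by eventually_elim auto
    ultimately have "\<phi>' -` A \<in> sets ?C"
      using completion.in_sets_AE[where A = "\<phi> -` A" and B = "\<phi>' -` A"] by simp
    then show "\<phi>' -` A \<inter> space ?C \<in> sets ?C" by simp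
  qed simp
  have set_int: "set_integrable ?C {p..<q} \<phi>' \<and> (LINT s:{p..<q}|?C. \<phi>' s) = (LINT s:{p..<q}|ls_measure g. \<phi> s)" for p q
  proof -
    have 1: "integrable ?C (\<lambda>s. indicator {p..<q} s *\<^sub>R \<phi> s)"
      using g_primitiveD(2)[OF F, of p q] by (subst integrable_completion) (auto simp: set_integrable_def)
    have AE2: "AE s in ?C. indicator {p..<q} s *\<^sub>R \<phi>' s = indicator {p..<q} s *\<^sub>R \<phi> s"
      using AE' by eventually_elim auto
    have m: "(\<lambda>s. indicator {p..<q} s *\<^sub>R \<phi>' s) \<in> borel_measurable ?C"
      using \<phi>' by (intro borel_measurable_scaleR borel_measurable_indicator) auto
    have m2: "(\<lambda>s. indicator {p..<q} s *\<^sub>R \<phi> s) \<in> borel_measurable ?C"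
      using 1 by auto
    have "integrable ?C (\<lambda>s. indicator {p..<q} s *\<^sub>R \<phi>' s)"
      using integrable_cong_AE[OF m m2 AE2] 1 by simp
    moreover have "integral\<^sup>L ?C (\<lambda>s. indicator {p..<q} s *\<^sub>R \<phi>' s) = integral\<^sup>L (ls_measure g) (\<lambda>s. indicator {p..<q} s *\<^sub>R \<phi> s)"
      using integral_cong_AE[OF m m2 AE2] by (simp add: integral_completion)
    ultimately show ?thesis by (simp add: set_integrable_def set_lebesgue_integral_def)
  qed
  show "g_integrable g x y \<phi>'"
    using set_int by (simp add: g_integrable_def stieltjes_measure_eq)
  show "g_integral g x y \<phi>' = F y - F x"
    using set_int g_primitiveD(3)[OF F, of x y] g_primitiveD(3)[OF F, of y x]
    by (auto simp: g_integral_def stieltjes_measure_eq)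
qed

end

section \<open>Variation over families of intervals\<close>

text \<open>Names the families quantified over in \<open>g_absolutely_continuous_on\<close>. The
  rules \<open>interval_familyI\<close> and \<open>interval_familyD\<close> trade disjointness of
  the open intervals for an ordering of their endpoints.\<close>

definition interval_family :: "real \<Rightarrow> real \<Rightarrow> (real \<times> real) set \<Rightarrow> bool" where
  "interval_family a b I \<longleftrightarrow> finite I \<and> (\<forall>(x, y)\<in>I. a \<le> x \<and> x < y \<and> y \<le> b) \<and>
     disjoint_family_on (\<lambda>(x, y). {x<..<y}) I"

lemma interval_familyI:
  assumes "finite I" "\<And>x y. (x, y) \<in> I \<Longrightarrow> a \<le> x \<and> x < y \<and> y \<le> b"
    and "\<And>x y x' y'. (x, y) \<in> I \<Longrightarrow> (x', y') \<in> I \<Longrightarrow> (x, y) \<noteq> (x', y') \<Longrightarrow> y \<le> x' \<or> y' \<le> x"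
  shows "interval_family a b I"
  unfolding interval_family_def disjoint_family_on_def
proof (intro conjI assms(1) ballI impI)
  fix k l assume "k \<in> I" "l \<in> I" "k \<noteq> l"
  then have "snd k \<le> fst l \<or> snd l \<le> fst k"
    using assms(3)[of "fst k" "snd k" "fst l" "snd l"] by (auto simp: prod_eq_iff)
  then show "(case k of (x, y) \<Rightarrow> {x<..<y}) \<inter> (case l of (x, y) \<Rightarrow> {x<..<y}) = {}"
    by (auto simp: case_prod_beta)
qed (use assms(2) in auto)

lemma interval_familyD:
  assumes "interval_family a b I"
  shows "finite I" "(x, y) \<in> I \<Longrightarrow> a \<le> x \<and> x < y \<and> y \<le> b"
    and "(x, y) \<in> I \<Longrightarrow> (x', y') \<in> I \<Longrightarrow> (x, y) \<noteq> (x', y') \<Longrightarrow> y \<le> x' \<or> y' \<le> x"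
proof -
  show *: "finite I" "(x, y) \<in> I \<Longrightarrow> a \<le> x \<and> x < y \<and> y \<le> b" for x y
    using assms by (auto simp: interval_family_def)
  show "y \<le> x' \<or> y' \<le> x" if "(x, y) \<in> I" "(x', y') \<in> I" "(x, y) \<noteq> (x', y')"
  proof (rule ccontr)
    assume "\<not> ?thesis"
    moreover have disj: "{x<..<y} \<inter> {x'<..<y'} = {}"
      using disjoint_family_onD[of "\<lambda>(x, y). {x<..<y}" I "(x, y)" "(x', y')"] assms that
      by (simp add: interval_family_def)
    moreover have "x < y" "x' < y'" using * that by auto
    ultimately have "max x x' < min y y'" by simp
    then obtain p where "max x x' < p" "p < min y y'" using dense by blast
    then have "p \<in> {x<..<y} \<inter> {x'<..<y'}" by simp
    then show False unfolding disj by simp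
  qed
qed

lemma interval_family_subset: "interval_family a b I \<Longrightarrow> J \<subseteq> I \<Longrightarrow> interval_family a b J"
  unfolding interval_family_def by (meson disjoint_family_on_mono finite_subset subsetD)

lemma interval_family_mono: "interval_family a b I \<Longrightarrow> a' \<le> a \<Longrightarrow> b \<le> b' \<Longrightarrow> interval_family a' b' I"
  by (auto simp: interval_family_def)

lemma interval_family_singleton: "a \<le> x \<Longrightarrow> x < y \<Longrightarrow> y \<le> b \<Longrightarrow> interval_family a b {(x, y)}"
  by (auto intro!: interval_familyI)

lemma interval_family_empty: "interval_family a b {}"
  by (auto intro!: interval_familyI)

lemma interval_family_Un:
  assumes I: "interval_family a b I" and J: "interval_family b c J" and "a \<le> b" "b \<le> c"
  shows "interval_family a c (I \<union> J)" "I \<inter> J = {}"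
proof -
  show "interval_family a c (I \<union> J)"
  proof (rule interval_familyI)
    show "a \<le> x \<and> x < y \<and> y \<le> c" if "(x, y) \<in> I \<union> J" for x y
      using that interval_familyD(2)[OF I, of x y] interval_familyD(2)[OF J, of x y] assms(3,4) by auto
    show "y \<le> x' \<or> y' \<le> x" if "(x, y) \<in> I \<union> J" "(x', y') \<in> I \<union> J" "(x, y) \<noteq> (x', y')" for x y x' y'
      using that interval_familyD(2,3)[OF I, of x y] interval_familyD(2,3)[OF I, of x' y']
        interval_familyD(2,3)[OF J, of x y] interval_familyD(2,3)[OF J, of x' y'] by fastforce
  qed (use interval_familyD(1) I J in auto)
  show "I \<inter> J = {}"
    using interval_familyD(2)[OF I] interval_familyD(2)[OF J] by fastforce
qed

text \<open>Refinement of a family. Members are nondegenerate and separated, so the refining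
  families share no pair and sums over the union split.\<close>

lemma interval_family_UN:
  assumes I: "interval_family a b I" and K: "\<And>i. i \<in> I \<Longrightarrow> interval_family (fst i) (snd i) (K i)"
  shows "interval_family a b (\<Union>i\<in>I. K i)" "i \<in> I \<Longrightarrow> j \<in> I \<Longrightarrow> i \<noteq> j \<Longrightarrow> K i \<inter> K j = {}"
proof -
  have sep: "snd k \<le> fst l \<or> snd l \<le> fst k" if "i \<in> I" "j \<in> I" "i \<noteq> j" "k \<in> K i" "l \<in> K j" for i j k l
  proof -
    have "snd i \<le> fst j \<or> snd j \<le> fst i"
      using interval_familyD(3)[OF I, of "fst i" "snd i" "fst j" "snd j"] that by (auto simp: prod_eq_iff)
    moreover have "fst i \<le> fst k" "snd k \<le> snd i" "fst j \<le> fst l" "snd l \<le> snd j"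
      using interval_familyD(2)[OF K[of i], of "fst k" "snd k"] interval_familyD(2)[OF K[of j], of "fst l" "snd l"] that
      by auto
    ultimately show ?thesis by auto
  qed
  show "interval_family a b (\<Union>i\<in>I. K i)"
  proof (rule interval_familyI)
    show "finite (\<Union>i\<in>I. K i)" using interval_familyD(1)[OF I] interval_familyD(1)[OF K] by auto
    show "a \<le> x \<and> x < y \<and> y \<le> b" if xy: "(x, y) \<in> (\<Union>i\<in>I. K i)" for x y
    proof -
      obtain i where i: "i \<in> I" "(x, y) \<in> K i" using xy by auto
      then show ?thesis
        using interval_familyD(2)[OF I, of "fst i" "snd i"] interval_familyD(2)[OF K[OF i(1)] i(2)] by auto
    qed
    show "y \<le> x' \<or> y' \<le> x" if xy: "(x, y) \<in> (\<Union>i\<in>I. K i)" "(x', y') \<in> (\<Union>i\<in>I. K i)" "(x, y) \<noteq> (x', y')" for x y x' y'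
    proof -
      obtain i j where ij: "i \<in> I" "(x, y) \<in> K i" "j \<in> I" "(x', y') \<in> K j" using xy by auto
      show ?thesis
      proof (cases "i = j")
        case True
        then show ?thesis using interval_familyD(3)[OF K[OF ij(1)] ij(2)] ij(4) xy(3) by auto
      next
        case False
        then show ?thesis using sep[OF ij(1,3) _ ij(2,4)] by auto
      qed
    qed
  qed
  show "K i \<inter> K j = {}" if "i \<in> I" "j \<in> I" "i \<noteq> j"
  proof (rule ccontr)
    assume "K i \<inter> K j \<noteq> {}"
    then obtain k where "k \<in> K i" "k \<in> K j" by auto
    then have "snd k \<le> fst k \<or> snd k \<le> fst k" "fst k < snd k"
      using sep[of i j k k] interval_familyD(2)[OF K[OF that(1)], of "fst k" "snd k"] that by auto
    then show False by simp
  qed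
qed

section \<open>Total variation and its additivity\<close>

definition increment_sum :: "(real \<Rightarrow> 'b::real_normed_vector) \<Rightarrow> (real \<times> real) set \<Rightarrow> real" where
  "increment_sum F I = (\<Sum>(x, y)\<in>I. norm (F y - F x))"

lemma increment_sum_nonneg: "increment_sum F I \<ge> 0"
  unfolding increment_sum_def by (intro sum_nonneg) auto

text \<open>At most one interval straddles \<open>b\<close>; cutting it there can only increase the
  sum, by the triangle inequality.\<close>

lemma interval_family_split:
  assumes I: "interval_family a c I" and "a \<le> b" "b \<le> c"
  obtains J K where "interval_family a b J" "interval_family b c K"
    "\<And>F :: real \<Rightarrow> 'b::real_normed_vector. increment_sum F I \<le> increment_sum F J + increment_sum F K"
proof -
  define J where "J = {k\<in>I. snd k \<le> b}"
  define K where "K = {k\<in>I. b \<le> fst k}"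
  define S where "S = {k\<in>I. fst k < b \<and> b < snd k}"
  have fin: "finite I" "finite J" "finite K" "finite S"
    using interval_familyD(1)[OF I] by (auto simp: J_def K_def S_def)
  have bounds: "a \<le> fst k \<and> fst k < snd k \<and> snd k \<le> c" if "k \<in> I" for k
    using interval_familyD(2)[OF I, of "fst k" "snd k"] that by auto
  have sep: "snd k \<le> fst l \<or> snd l \<le> fst k" if "k \<in> I" "l \<in> I" "k \<noteq> l" for k l
    using interval_familyD(3)[OF I, of "fst k" "snd k" "fst l" "snd l"] that by (auto simp: prod_eq_iff)
  have J: "interval_family a b J"
    using interval_family_subset[OF I, of J] by (auto simp: J_def interval_family_def)
  have K: "interval_family b c K"
    using interval_family_subset[OF I, of K] by (auto simp: K_def interval_family_def)
  have "I = (J \<union> K) \<union> S" using bounds by (force simp: J_def K_def S_def)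
  moreover have "J \<inter> K = {}" using bounds by (force simp: J_def K_def)
  moreover have "(J \<union> K) \<inter> S = {}" by (auto simp: J_def K_def S_def)
  ultimately have I_sum: "increment_sum F I = increment_sum F J + increment_sum F K + increment_sum F S"
    for F :: "real \<Rightarrow> 'b"
    using fin by (simp add: increment_sum_def sum.union_disjoint)
  show thesis
  proof (cases "S = {}")
    case True
    show thesis
    proof (rule that[OF J K])
      show "increment_sum F I \<le> increment_sum F J + increment_sum F K" for F :: "real \<Rightarrow> 'b"
        using I_sum[of F] by (simp add: True increment_sum_def[of F "{}"])
    qed
  next
    case False
    then obtain k where k: "k \<in> I" "fst k < b" "b < snd k" by (auto simp: S_def)
    have S: "S = {k}"
    proof -
      have "l = k" if l: "l \<in> S" for l
      proof (rule ccontr)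
        assume "l \<noteq> k"
        then have "snd k \<le> fst l \<or> snd l \<le> fst k" using l k by (intro sep) (auto simp: S_def)
        then show False using l k by (auto simp: S_def)
      qed
      then show ?thesis using False by blast
    qed
    have kb: "a \<le> fst k" "snd k \<le> c" using bounds[OF k(1)] by auto
    have J_le: "y \<le> fst k" if "(x, y) \<in> J" for x y
    proof -
      have "snd k \<le> x \<or> y \<le> fst k"
        using that k by (intro sep[of k "(x, y)", unfolded fst_conv snd_conv]) (auto simp: J_def)
      then show ?thesis using that k bounds[of "(x, y)"] by (auto simp: J_def)
    qed
    have K_ge: "snd k \<le> x" if "(x, y) \<in> K" for x y
    proof -
      have "snd k \<le> x \<or> y \<le> fst k"
        using that k by (intro sep[of k "(x, y)", unfolded fst_conv snd_conv]) (auto simp: K_def)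
      then show ?thesis using that k bounds[of "(x, y)"] by (auto simp: K_def)
    qed
    have notin: "(fst k, b) \<notin> J" "(b, snd k) \<notin> K"
      using J_le[of "fst k" b] K_ge[of b "snd k"] k by auto
    have J': "interval_family a b (insert (fst k, b) J)"
    proof (rule interval_familyI)
      fix x y x' y' assume *: "(x, y) \<in> insert (fst k, b) J" "(x', y') \<in> insert (fst k, b) J" "(x, y) \<noteq> (x', y')"
      then show "y \<le> x' \<or> y' \<le> x"
        using interval_familyD(3)[OF J, of x y x' y'] J_le[of x y] J_le[of x' y'] by auto
    next
      fix x y assume "(x, y) \<in> insert (fst k, b) J"
      then show "a \<le> x \<and> x < y \<and> y \<le> b"
        using interval_familyD(2)[OF J, of x y] k kb by auto
    qed (use fin in auto)
    have K': "interval_family b c (insert (b, snd k) K)"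
    proof (rule interval_familyI)
      fix x y x' y' assume *: "(x, y) \<in> insert (b, snd k) K" "(x', y') \<in> insert (b, snd k) K" "(x, y) \<noteq> (x', y')"
      then show "y \<le> x' \<or> y' \<le> x"
        using interval_familyD(3)[OF K, of x y x' y'] K_ge[of x y] K_ge[of x' y'] by auto
    next
      fix x y assume "(x, y) \<in> insert (b, snd k) K"
      then show "b \<le> x \<and> x < y \<and> y \<le> c"
        using interval_familyD(2)[OF K, of x y] k kb by auto
    qed (use fin in auto)
    show thesis
    proof (rule that[OF J' K'])
      fix F :: "real \<Rightarrow> 'b"
      have "norm (F (snd k) - F (fst k)) \<le> norm (F b - F (fst k)) + norm (F (snd k) - F b)"
        using norm_triangle_ineq[of "F b - F (fst k)" "F (snd k) - F b"] by simp
      then show "increment_sum F I \<le> increment_sum F (insert (fst k, b) J) + increment_sum F (insert (b, snd k) K)"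
        unfolding I_sum S using fin notin by (simp add: increment_sum_def case_prod_beta)
    qed
  qed
qed

text \<open>Valued in \<open>ennreal\<close> because additivity enters the proof of finiteness and
  so must make sense before it.\<close>

definition variation :: "(real \<Rightarrow> 'b::real_normed_vector) \<Rightarrow> real \<Rightarrow> real \<Rightarrow> ennreal" where
  "variation F a b = (SUP I\<in>{I. interval_family a b I}. ennreal (increment_sum F I))"

lemma increment_sum_le_variation: "interval_family a b I \<Longrightarrow> ennreal (increment_sum F I) \<le> variation F a b"
  unfolding variation_def by (intro SUP_upper) auto

lemma variation_least: "(\<And>I. interval_family a b I \<Longrightarrow> ennreal (increment_sum F I) \<le> c) \<Longrightarrow> variation F a b \<le> c"
  unfolding variation_def by (intro SUP_least) auto

lemma norm_diff_le_variation:
  assumes "x \<le> y"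
  shows "ennreal (norm (F y - F x)) \<le> variation F x y"
proof (cases "x = y")
  case False
  then show ?thesis
    using increment_sum_le_variation[OF interval_family_singleton[of x x y y], of F] assms
    by (simp add: increment_sum_def)
qed auto

text \<open>Splitting at \<open>b\<close> loses nothing, and families on the two sides can be chosen
  independently and united, so the two suprema add.\<close>

lemma variation_add:
  assumes "a \<le> b" "b \<le> c"
  shows "variation F a c = variation F a b + variation F b c"
proof (rule antisym)
  show "variation F a c \<le> variation F a b + variation F b c"
  proof (rule variation_least)
    fix I assume "interval_family a c I"
    then obtain J K where JK: "interval_family a b J" "interval_family b c K"
      "\<And>F :: real \<Rightarrow> 'a. increment_sum F I \<le> increment_sum F J + increment_sum F K"
      using interval_family_split assms by metis
    have "ennreal (increment_sum F I) \<le> ennreal (increment_sum F J + increment_sum F K)"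
      using JK(3) by (rule ennreal_leI)
    also have "\<dots> = ennreal (increment_sum F J) + ennreal (increment_sum F K)"
      by (simp add: increment_sum_nonneg)
    also have "\<dots> \<le> variation F a b + variation F b c"
      using JK by (intro add_mono increment_sum_le_variation)
    finally show "ennreal (increment_sum F I) \<le> variation F a b + variation F b c" .
  qed
  have ne: "{I. interval_family x y I} \<noteq> {}" for x y using interval_family_empty by auto
  have "ennreal (increment_sum F I) + variation F b c \<le> variation F a c" if I: "interval_family a b I" for I
  proof -
    have "ennreal (increment_sum F J) + ennreal (increment_sum F I) \<le> variation F a c" if J: "interval_family b c J" for J
    proof -
      have "increment_sum F (I \<union> J) = increment_sum F I + increment_sum F J"
        using interval_family_Un[OF I J assms] interval_familyD(1)[OF I] interval_familyD(1)[OF J]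
        by (simp add: increment_sum_def sum.union_disjoint)
      then show ?thesis
        using increment_sum_le_variation[OF interval_family_Un(1)[OF I J assms], of F]
        by (simp add: increment_sum_nonneg add.commute)
    qed
    then show ?thesis
      unfolding variation_def[of F b c] by (subst add.commute, subst ennreal_SUP_add_left[OF ne, symmetric]) (auto intro: SUP_least)
  qed
  then show "variation F a b + variation F b c \<le> variation F a c"
    unfolding variation_def[of F a b] by (subst ennreal_SUP_add_left[OF ne, symmetric]) (auto intro: SUP_least)
qed

text \<open>The suprema run over independent choices and are taken one index at a time;
  \<open>c\<close> holds the terms of the indices already treated, which is what the induction
  needs.\<close>

lemma sum_SUP_le_ennreal:
  fixes f :: "'i \<Rightarrow> 'k \<Rightarrow> ennreal"
  assumes "finite I" "\<And>i. i \<in> I \<Longrightarrow> A i \<noteq> {}"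
    and "\<And>K. (\<And>i. i \<in> I \<Longrightarrow> K i \<in> A i) \<Longrightarrow> c + (\<Sum>i\<in>I. f i (K i)) \<le> e"
  shows "c + (\<Sum>i\<in>I. SUP k\<in>A i. f i k) \<le> e"
  using assms
proof (induction I arbitrary: c rule: finite_induct)
  case (insert j I)
  have "(c + f j k) + (\<Sum>i\<in>I. SUP k\<in>A i. f i k) \<le> e" if "k \<in> A j" for k
  proof (rule insert.IH)
    fix K assume K: "\<And>i. i \<in> I \<Longrightarrow> K i \<in> A i"
    have "(\<Sum>i\<in>I. f i ((K(j := k)) i)) = (\<Sum>i\<in>I. f i (K i))"
      using insert.hyps by (intro sum.cong) auto
    moreover have "(K(j := k)) i \<in> A i" if "i \<in> insert j I" for i
      using that K \<open>k \<in> A j\<close> by auto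
    ultimately show "c + f j k + (\<Sum>i\<in>I. f i (K i)) \<le> e"
      using insert.prems(2)[of "K(j := k)"] insert.hyps by (simp add: add.assoc)
  qed (use insert.prems in auto)
  then have "(SUP k\<in>A j. f j k + (c + (\<Sum>i\<in>I. SUP k\<in>A i. f i k))) \<le> e"
    by (intro SUP_least) (simp add: add_ac)
  then have "(SUP k\<in>A j. f j k) + (c + (\<Sum>i\<in>I. SUP k\<in>A i. f i k)) \<le> e"
    using insert.prems(1) by (subst ennreal_SUP_add_left[symmetric]) auto
  then show ?case using insert.hyps by (simp add: add_ac)
next
  case empty
  from empty(2)[of undefined] show ?case by simp
qed

text \<open>
  Half-open dyadic intervals instead of components of \<open>U\<close>: their Stieltjes measure is an
  increment of the derivator even when an endpoint is a jump.
\<close>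

lemma open_eq_Union_dyadic:
  fixes U :: "real set"
  assumes "open U" "U \<subseteq> {a<..<b}"
  obtains I where "\<And>k::nat. interval_family a b (I k)" "incseq (\<lambda>k. \<Union>(x, y)\<in>I k. {x..<y})"
    "(\<Union>k. \<Union>(x, y)\<in>I k. {x..<y}) = U"
proof -
  define D where "D k j = (real_of_int j / 2 ^ k, real_of_int (j + 1) / 2 ^ k)" for k and j :: int
  define C where "C k = {j. {fst (D k j)..<snd (D k j)} \<subseteq> U}" for k
  have lt: "fst (D k j) < snd (D k j)" for k j by (simp add: D_def divide_strict_right_mono)
  \<comment> \<open>At each level exactly one dyadic interval contains \<open>p\<close>, indexed by
    a floor; membership in the unions becomes a statement about that index.\<close>
  have mem: "p \<in> {fst (D k j)..<snd (D k j)} \<longleftrightarrow> j = \<lfloor>p * 2 ^ k\<rfloor>" for p k j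
  proof -
    have "p \<in> {fst (D k j)..<snd (D k j)} \<longleftrightarrow> real_of_int j \<le> p * 2 ^ k \<and> p * 2 ^ k < real_of_int j + 1"
      by (simp add: D_def divide_le_eq less_divide_eq)
    also have "\<dots> \<longleftrightarrow> j = \<lfloor>p * 2 ^ k\<rfloor>" by (metis floor_eq_iff)
    finally show ?thesis .
  qed
  have mem_self: "p \<in> {fst (D k \<lfloor>p * 2 ^ k\<rfloor>)..<snd (D k \<lfloor>p * 2 ^ k\<rfloor>)}" for p k
    by (simp only: mem)
  have bounds: "a < fst (D k j) \<and> snd (D k j) \<le> b" if "j \<in> C k" for k j
  proof -
    have sub: "{fst (D k j)..<snd (D k j)} \<subseteq> {a<..<b}" using that assms by (auto simp: C_def)
    have "fst (D k j) \<in> {a<..<b}" using sub lt[of k j] by auto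
    moreover have "snd (D k j) \<le> b"
    proof (rule ccontr)
      assume "\<not> snd (D k j) \<le> b"
      \<comment> \<open>A point at or beyond \<open>b\<close> that the interval would have to
        contain.\<close>
      then have "max b (fst (D k j)) \<in> {fst (D k j)..<snd (D k j)}" using lt by auto
      then have "max b (fst (D k j)) \<in> {a<..<b}" using sub by blast
      then show False by simp
    qed
    ultimately show ?thesis by auto
  qed
  have fin: "finite (C k)" for k
  proof (rule finite_subset)
    show "C k \<subseteq> {\<lfloor>a * 2 ^ k\<rfloor>..\<lceil>b * 2 ^ k\<rceil>}"
    proof
      fix j assume "j \<in> C k"
      then have "a * 2 ^ k < real_of_int j" "real_of_int (j + 1) \<le> b * 2 ^ k"
        using bounds[of j k] by (auto simp: D_def field_simps)
      then show "j \<in> {\<lfloor>a * 2 ^ k\<rfloor>..\<lceil>b * 2 ^ k\<rceil>}" by (auto simp: floor_le_iff le_ceiling_iff)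
    qed
  qed auto
  \<comment> \<open>The interval of level \<open>Suc k\<close> around \<open>p\<close> is one half
    of that of level \<open>k\<close>, hence also lies in \<open>U\<close>; this makes the unions
    increase.\<close>
  have step: "D (Suc k) \<lfloor>p * 2 ^ Suc k\<rfloor> \<in> D (Suc k) ` C (Suc k)" if "\<lfloor>p * 2 ^ k\<rfloor> \<in> C k" for p :: real and k
  proof -
    let ?j = "\<lfloor>p * 2 ^ k\<rfloor>" and ?i = "\<lfloor>p * 2 ^ Suc k\<rfloor>"
    have "real_of_int ?j \<le> p * 2 ^ k" "p * 2 ^ k < real_of_int ?j + 1"
      by linarith+
    then have "real_of_int (2 * ?j) \<le> p * 2 ^ Suc k" "p * 2 ^ Suc k < real_of_int (2 * (?j + 1))"
      by (simp_all add: algebra_simps)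
    then have "2 * ?j \<le> ?i" "?i + 1 \<le> 2 * (?j + 1)"
      by (simp_all only: le_floor_iff floor_less_iff add1_zle_eq)
    then have "real_of_int (2 * ?j) \<le> real_of_int ?i" "real_of_int (?i + 1) \<le> real_of_int (2 * (?j + 1))"
      by (simp_all only: of_int_le_iff)
    moreover have "fst (D k ?j) = real_of_int (2 * ?j) / 2 ^ Suc k" "snd (D k ?j) = real_of_int (2 * (?j + 1)) / 2 ^ Suc k"
      by (simp_all add: D_def add_divide_distrib)
    ultimately have "fst (D k ?j) \<le> fst (D (Suc k) ?i)" "snd (D (Suc k) ?i) \<le> snd (D k ?j)"
      by (simp_all only: D_def fst_conv snd_conv) (intro divide_right_mono; simp)+
    then have "{fst (D (Suc k) ?i)..<snd (D (Suc k) ?i)} \<subseteq> {fst (D k ?j)..<snd (D k ?j)}"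
      by (intro ivl_subset[THEN iffD2] disjI2 conjI)
    also have "\<dots> \<subseteq> U" using that by (simp only: C_def mem_Collect_eq)
    finally have "?i \<in> C (Suc k)" by (simp only: C_def mem_Collect_eq)
    then show ?thesis by simp
  qed
  have mem_Un: "p \<in> (\<Union>(x, y)\<in>D k ` C k. {x..<y}) \<longleftrightarrow> \<lfloor>p * 2 ^ k\<rfloor> \<in> C k" for p k
  proof -
    have "p \<in> (\<Union>(x, y)\<in>D k ` C k. {x..<y}) \<longleftrightarrow> (\<exists>j\<in>C k. p \<in> {fst (D k j)..<snd (D k j)})"
      by (simp add: case_prod_beta)
    then show ?thesis by (simp only: mem) auto
  qed
  show thesis
  proof
    show "interval_family a b (D k ` C k)" for k
    proof (rule interval_familyI)
      show "a \<le> x \<and> x < y \<and> y \<le> b" if "(x, y) \<in> D k ` C k" for x y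
        using that bounds[of _ k] lt[of k] by (metis fst_conv imageE less_imp_le snd_conv)
      fix x y x' y' assume "(x, y) \<in> D k ` C k" "(x', y') \<in> D k ` C k" and ne: "(x, y) \<noteq> (x', y')"
      then obtain i j where ij: "(x, y) = D k i" "(x', y') = D k j" by auto
      then have "i \<noteq> j" using ne by auto
      then have "i + 1 \<le> j \<or> j + 1 \<le> i" by linarith
      then have "real_of_int (i + 1) \<le> real_of_int j \<or> real_of_int (j + 1) \<le> real_of_int i" by (simp only: of_int_le_iff)
      then show "y \<le> x' \<or> y' \<le> x" using ij by (auto simp: D_def divide_right_mono)
    qed (use fin in auto)
    show "incseq (\<lambda>k. \<Union>(x, y)\<in>D k ` C k. {x..<y})"
    proof (intro incseq_SucI subsetI)
      fix k p assume "p \<in> (\<Union>(x, y)\<in>D k ` C k. {x..<y})"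
      then have "D (Suc k) \<lfloor>p * 2 ^ Suc k\<rfloor> \<in> D (Suc k) ` C (Suc k)" 
        by (intro step) (simp only: mem_Un)
      moreover have "p \<in> {fst (D (Suc k) \<lfloor>p * 2 ^ Suc k\<rfloor>)..<snd (D (Suc k) \<lfloor>p * 2 ^ Suc k\<rfloor>)}"
        by (rule mem_self)
      ultimately show "p \<in> (\<Union>(x, y)\<in>D (Suc k) ` C (Suc k). {x..<y})"
        by (intro UN_I) (auto simp: case_prod_beta)
    qed
    show "(\<Union>k. \<Union>(x, y)\<in>D k ` C k. {x..<y}) = U"
    proof (intro equalityI subsetI)
      fix p assume "p \<in> (\<Union>k. \<Union>(x, y)\<in>D k ` C k. {x..<y})"
      then obtain k where "\<lfloor>p * 2 ^ k\<rfloor> \<in> C k" by (auto simp only: UN_iff[of _ _ UNIV] mem_Un)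
      moreover have "p \<in> {fst (D k \<lfloor>p * 2 ^ k\<rfloor>)..<snd (D k \<lfloor>p * 2 ^ k\<rfloor>)}" by (rule mem_self)
      ultimately show "p \<in> U" by (auto simp: C_def)
    next
      fix p assume "p \<in> U"
      then obtain e where e: "e > 0" "ball p e \<subseteq> U" using assms(1) openE by blast
      obtain k where k: "inverse (2 ^ k) < e" using real_arch_pow_inv[of e "1/2"] e(1) by (auto simp: power_one_over inverse_eq_divide)
      let ?j = "\<lfloor>p * 2 ^ k\<rfloor>"
      have pin: "p \<in> {fst (D k ?j)..<snd (D k ?j)}" by (rule mem_self)
      have len: "snd (D k ?j) - fst (D k ?j) < e" using k by (simp add: D_def diff_divide_distrib[symmetric] inverse_eq_divide)
      have "{fst (D k ?j)..<snd (D k ?j)} \<subseteq> ball p e"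
        using pin len by (auto simp: dist_real_def)
      then have "?j \<in> C k" using e(2) by (auto simp: C_def)
      then show "p \<in> (\<Union>k. \<Union>(x, y)\<in>D k ` C k. {x..<y})" 
        by (intro UN_I[of k]) (simp_all only: mem_Un UNIV_I)
    qed
  qed
qed

context derivator_on_line begin

section \<open>Absolutely continuous functions are primitives\<close>

lemma g_absolutely_continuous_iff:
  "g_absolutely_continuous g F \<longleftrightarrow> (\<forall>a b. a < b \<longrightarrow> (\<forall>e>0. \<exists>d>0. \<forall>I.
     interval_family a b I \<and> (\<Sum>(x, y)\<in>I. g y - g x) < d \<longrightarrow> increment_sum F I < e))"
  unfolding g_absolutely_continuous_def g_absolutely_continuous_on_def
    interval_family_def increment_sum_def by (simp only: conj_assoc)

lemma g_absolutely_continuousE: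
  assumes "g_absolutely_continuous g F" "a < b" "e > 0"
  obtains d where "d > 0"
    "\<And>I. interval_family a b I \<Longrightarrow> (\<Sum>(x, y)\<in>I. g y - g x) < d \<Longrightarrow> increment_sum F I < e"
proof -
  from assms(1)[unfolded g_absolutely_continuous_iff, rule_format, OF assms(2,3)]
  obtain d where d: "d > 0 \<and> (\<forall>I. interval_family a b I \<and> (\<Sum>(x, y)\<in>I. g y - g x) < d \<longrightarrow> increment_sum F I < e)"
    by (rule exE)
  show thesis using d by (intro that[of d]) simp_all
qed

lemma g_absolutely_continuousI:
  assumes "\<And>a b e. a < b \<Longrightarrow> e > 0 \<Longrightarrow> \<exists>d>0. \<forall>I. interval_family a b I \<and> (\<Sum>(x, y)\<in>I. g y - g x) < d \<longrightarrow>
      increment_sum F I < e"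
  shows "g_absolutely_continuous g F"
  unfolding g_absolutely_continuous_iff by (intro allI impI) (rule assms)

lemma emeasure_interval_family:
  assumes I: "interval_family a b I"
  shows "emeasure (ls_measure g) (\<Union>(x, y)\<in>I. {x..<y}) = ennreal (\<Sum>(x, y)\<in>I. g y - g x)"
proof -
  have le: "g (fst k) \<le> g (snd k)" if "k \<in> I" for k
    using interval_familyD(2)[OF I, of "fst k" "snd k"] that by (intro mono_g) auto
  have disj: "disjoint_family_on (\<lambda>(x, y). {x..<y}) I"
    unfolding disjoint_family_on_def
  proof (intro ballI impI)
    fix k l assume "k \<in> I" "l \<in> I" "k \<noteq> l"
    then have "snd k \<le> fst l \<or> snd l \<le> fst k"
      using interval_familyD(3)[OF I, of "fst k" "snd k" "fst l" "snd l"] by (simp add: prod_eq_iff)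
    then show "(case k of (x, y) \<Rightarrow> {x..<y}) \<inter> (case l of (x, y) \<Rightarrow> {x..<y}) = {}"
      by (auto simp: case_prod_beta)
  qed
  have "emeasure (ls_measure g) (\<Union>(x, y)\<in>I. {x..<y}) = (\<Sum>k\<in>I. emeasure (ls_measure g) (case k of (x, y) \<Rightarrow> {x..<y}))"
    using interval_familyD(1)[OF I] disj by (intro sum_emeasure[symmetric]) auto
  also have "\<dots> = (\<Sum>k\<in>I. ennreal (g (snd k) - g (fst k)))"
  proof (intro sum.cong refl)
    fix k assume "k \<in> I"
    then have "fst k \<le> snd k" using interval_familyD(2)[OF I, of "fst k" "snd k"] by simp
    then show "emeasure (ls_measure g) (case k of (x, y) \<Rightarrow> {x..<y}) = ennreal (g (snd k) - g (fst k))"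
      by (simp add: case_prod_beta emeasure_Ico)
  qed
  also have "\<dots> = ennreal (\<Sum>(x, y)\<in>I. g y - g x)"
    using le by (subst sum_ennreal) (auto simp: case_prod_beta)
  finally show ?thesis .
qed

text \<open>The half-open intervals are disjoint subsets of \<open>{a..<b}\<close>, so monotonicity
  of the measure replaces sorting the endpoints.\<close>

lemma interval_family_sum_le:
  assumes I: "interval_family a b I" and "a \<le> b"
  shows "(\<Sum>(x, y)\<in>I. g y - g x) \<le> g b - g a"
proof -
  have "ennreal (\<Sum>(x, y)\<in>I. g y - g x) \<le> emeasure (ls_measure g) {a..<b}"
    unfolding emeasure_interval_family[OF I, symmetric]
  proof (rule emeasure_mono)
    show "(\<Union>(x, y)\<in>I. {x..<y}) \<subseteq> {a..<b}"
    proof (rule UN_least)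
      fix k assume "k \<in> I"
      then show "(case k of (x, y) \<Rightarrow> {x..<y}) \<subseteq> {a..<b}"
        using interval_familyD(2)[OF I, of "fst k" "snd k"] by (simp add: case_prod_beta)
    qed
  qed simp
  then show ?thesis using \<open>a \<le> b\<close> mono_g[of a b] by (simp add: emeasure_Ico ennreal_le_iff)
qed

lemma g_absolutely_continuous_dominated:
  assumes V: "g_absolutely_continuous g V"
    and le: "\<And>x y. x \<le> y \<Longrightarrow> norm (F y - F x) \<le> c * norm (V y - V x)"
  shows "g_absolutely_continuous g F"
proof (rule g_absolutely_continuousI)
  fix a b e :: real assume "a < b" "e > 0"
  \<comment> \<open>\<open>\<bar>c\<bar> + 1\<close> is positive even when \<open>c\<close> is
    not.\<close>
  then have "e / (\<bar>c\<bar> + 1) > 0" by (simp add: divide_pos_pos)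
  from g_absolutely_continuousE[OF V \<open>a < b\<close> this] obtain d where d: "d > 0"
    "\<And>I. interval_family a b I \<Longrightarrow> (\<Sum>(x, y)\<in>I. g y - g x) < d \<Longrightarrow> increment_sum V I < e / (\<bar>c\<bar> + 1)"
    by blast
  show "\<exists>d>0. \<forall>I. interval_family a b I \<and> (\<Sum>(x, y)\<in>I. g y - g x) < d \<longrightarrow> increment_sum F I < e"
  proof (intro exI[of _ d] conjI d(1) allI impI)
    fix I assume I: "interval_family a b I \<and> (\<Sum>(x, y)\<in>I. g y - g x) < d"
    have "increment_sum F I \<le> (\<Sum>k\<in>I. (\<bar>c\<bar> + 1) * norm (V (snd k) - V (fst k)))"
      unfolding increment_sum_def case_prod_beta
    proof (rule sum_mono)
      fix k assume "k \<in> I"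
      then have "norm (F (snd k) - F (fst k)) \<le> c * norm (V (snd k) - V (fst k))"
        using I interval_familyD(2)[of a b I "fst k" "snd k"] by (intro le) auto
      also have "\<dots> \<le> (\<bar>c\<bar> + 1) * norm (V (snd k) - V (fst k))" by (intro mult_right_mono) auto
      finally show "norm (F (snd k) - F (fst k)) \<le> (\<bar>c\<bar> + 1) * norm (V (snd k) - V (fst k))" .
    qed
    also have "\<dots> = (\<bar>c\<bar> + 1) * increment_sum V I"
      by (simp add: increment_sum_def case_prod_beta sum_distrib_left)
    also have "\<dots> < e" using d(2)[of I] I by (simp add: less_divide_eq mult.commute)
    finally show "increment_sum F I < e" .
  qed
qed

text \<open>A single interval ending at \<open>t\<close> is a family, and its
  \<open>g\<close>-increment becomes small by left continuity. This makes absolutely continuous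
  monotone functions derivators.\<close>

lemma g_absolutely_continuous_tendsto_left:
  assumes F: "g_absolutely_continuous g F"
  shows "(F \<longlongrightarrow> F t) (at_left t)"
  unfolding tendsto_iff
proof (intro allI impI)
  fix e :: real assume "e > 0"
  then obtain d where d: "d > 0"
    "\<And>I. interval_family (t - 1) t I \<Longrightarrow> (\<Sum>(x, y)\<in>I. g y - g x) < d \<Longrightarrow> increment_sum F I < e"
    using g_absolutely_continuousE[OF F, of "t - 1" t e] by auto
  have "eventually (\<lambda>s. g t - d < g s) (at_left t)"
    using d(1) by (intro order_tendstoD[OF g_tendsto_left]) auto
  moreover have "eventually (\<lambda>s. s \<in> {t - 1<..<t}) (at_left t)"
    by (intro eventually_at_leftI[of "t - 1"]) auto
  ultimately show "eventually (\<lambda>s. dist (F s) (F t) < e) (at_left t)"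
  proof eventually_elim
    case (elim s)
    then show ?case
      using d(2)[OF interval_family_singleton[of "t - 1" s t t]]
      by (simp add: increment_sum_def dist_norm norm_minus_commute)
  qed
qed

text \<open>Replace every interval by an arbitrary family inside it: the pieces form one family
  whose total \<open>g\<close>-increment is no larger, so the \<open>d\<close> belonging to
  \<open>F\<close> still works. Passing to suprema weakens \<open>< e\<close> to
  \<open>\<le> e\<close>.\<close>

lemma sum_variation_le:
  assumes F: "g_absolutely_continuous g F" and "a < b" "e > 0"
  obtains d where "d > 0"
    "\<And>I. interval_family a b I \<Longrightarrow> (\<Sum>(x, y)\<in>I. g y - g x) < d \<Longrightarrow> (\<Sum>(x, y)\<in>I. variation F x y) \<le> ennreal e"
proof -
  obtain d where d: "d > 0"
    "\<And>I. interval_family a b I \<Longrightarrow> (\<Sum>(x, y)\<in>I. g y - g x) < d \<Longrightarrow> increment_sum F I < e"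
    using g_absolutely_continuousE[OF assms] by blast
  show thesis
  proof (rule that[OF d(1)])
    fix I assume I: "interval_family a b I" "(\<Sum>(x, y)\<in>I. g y - g x) < d"
    have "0 + (\<Sum>i\<in>I. SUP J\<in>{J. interval_family (fst i) (snd i) J}. ennreal (increment_sum F J)) \<le> ennreal e"
    proof (rule sum_SUP_le_ennreal)
      fix K assume "\<And>i. i \<in> I \<Longrightarrow> K i \<in> {J. interval_family (fst i) (snd i) J}"
      then have K: "interval_family (fst i) (snd i) (K i)" if "i \<in> I" for i using that by auto
      note U = interval_family_UN[OF I(1) K]
      have sum_U: "sum f (\<Union>i\<in>I. K i) = (\<Sum>i\<in>I. sum f (K i))" for f :: "real \<times> real \<Rightarrow> real"
        using interval_familyD(1)[OF I(1)] interval_familyD(1)[OF K] U(2) by (intro sum.UNION_disjoint) auto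
      have "(\<Sum>(x, y)\<in>(\<Union>i\<in>I. K i). g y - g x) \<le> (\<Sum>(x, y)\<in>I. g y - g x)"
        unfolding sum_U
      proof (rule sum_mono)
        fix i assume "i \<in> I"
        then show "(\<Sum>(x, y)\<in>K i. g y - g x) \<le> (case i of (x, y) \<Rightarrow> g y - g x)"
          using interval_family_sum_le[OF K] interval_familyD(2)[OF I(1), of "fst i" "snd i"]
          by (simp add: case_prod_beta)
      qed
      then have "increment_sum F (\<Union>i\<in>I. K i) < e" using I(2) by (intro d(2) U(1)) auto
      moreover have "increment_sum F (\<Union>i\<in>I. K i) = (\<Sum>i\<in>I. increment_sum F (K i))"
        unfolding increment_sum_def by (rule sum_U)
      ultimately show "0 + (\<Sum>i\<in>I. ennreal (increment_sum F (K i))) \<le> ennreal e"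
        by (simp add: increment_sum_nonneg sum_ennreal ennreal_leI)
    qed (use interval_familyD(1)[OF I(1)] interval_family_empty in auto)
    then show "(\<Sum>(x, y)\<in>I. variation F x y) \<le> ennreal e"
      by (simp add: variation_def case_prod_beta)
  qed
qed

text \<open>Finiteness is additive, so it has to be shown only near each \<open>t\<close>. On the
  left \<open>g\<close> is continuous and short intervals have variation at most 1. On the right the
  increment of \<open>g\<close> includes the jump at \<open>t\<close> and may stay above
  \<open>d\<close>; but at most one interval of a family starts at \<open>t\<close>, and only that
  one feels the jump.\<close>

lemma variation_finite:
  assumes F: "g_absolutely_continuous g F" and "a \<le> b"
  shows "variation F a b < \<infinity>"
  using \<open>a \<le> b\<close>
proof (induction rule: Bolzano)
  case (trans a b c)
  then show ?case by (simp add: variation_add[of a b c F])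
next
  case (local t)
  obtain d where d: "d > 0"
    "\<And>I. interval_family (t - 1) (t + 1) I \<Longrightarrow> (\<Sum>(x, y)\<in>I. g y - g x) < d \<Longrightarrow> increment_sum F I < 1"
    using g_absolutely_continuousE[OF F, of "t - 1" "t + 1" 1] by auto
  have small: "increment_sum F I < 1"
    if "interval_family p q I" "t - 1 \<le> p" "p \<le> q" "q \<le> t + 1" "g q - g p < d" for p q I
    using interval_family_sum_le[OF that(1,3)] that
    by (intro d(2) interval_family_mono[OF that(1)]) auto
  have "eventually (\<lambda>s. g t - d < g s) (at_left t)"
    using d(1) by (intro order_tendstoD[OF g_tendsto_left]) auto
  then obtain p0 where p0: "p0 < t" "\<And>s. p0 < s \<Longrightarrow> s < t \<Longrightarrow> g t - d < g s"
    by (auto simp: eventually_at_left_field)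
  have "eventually (\<lambda>s. g s < g t + jump g t + d) (at_right t)"
    using d(1) by (intro order_tendstoD[OF g_tendsto_right]) auto
  then obtain q0 where q0: "t < q0" "\<And>s. t < s \<Longrightarrow> s < q0 \<Longrightarrow> g s < g t + jump g t + d"
    by (auto simp: eventually_at_right_field)
  show ?case
  proof (intro exI[of _ "min 1 (min (t - p0) (q0 - t))"] conjI allI impI)
    fix p q assume pq: "p \<le> t \<and> t \<le> q \<and> q - p < min 1 (min (t - p0) (q0 - t))"
    have "variation F p t \<le> 1"
    proof (rule variation_least)
      fix I assume I: "interval_family p t I"
      have "g t - g p < d" using p0(2)[of p] pq d(1) by (cases "p = t") auto
      then have "increment_sum F I < 1" using small[OF I] pq by auto
      then show "ennreal (increment_sum F I) \<le> 1" by (simp add: ennreal_leI flip: ennreal_1)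
    qed
    \<comment> \<open>In the bound, \<open>norm (F q - F t) + 1\<close> accounts for the interval
      starting at \<open>t\<close>, the remaining 1 for all others.\<close>
    moreover have "variation F t q \<le> ennreal (norm (F q - F t) + 2)"
    proof (rule variation_least)
      fix I assume I: "interval_family t q I"
      \<comment> \<open>Past \<open>t\<close> the jump is already spent: \<open>g q - g u\<close> is
        at most \<open>g q - g t - jump g t\<close>, which is below \<open>d\<close>.\<close>
      have right: "increment_sum F J < 1" if "interval_family u q J" "t < u" "u \<le> q" for u J
        using small[OF that(1)] that q0(2)[of q] jump_le[of t u] pq by auto
      show "ennreal (increment_sum F I) \<le> ennreal (norm (F q - F t) + 2)"
      proof (cases "\<exists>y. (t, y) \<in> I")
        case True
        then obtain y where y: "(t, y) \<in> I" by auto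
        have ty: "t < y" "y \<le> q" using interval_familyD(2)[OF I y] by auto
        have J: "interval_family y q (I - {(t, y)})"
        proof (rule interval_familyI)
          fix x x' assume x: "(x, x') \<in> I - {(t, y)}"
          then have "t \<le> x" "x < x'" "x' \<le> q" using interval_familyD(2)[OF I, of x x'] by auto
          then show "y \<le> x \<and> x < x' \<and> x' \<le> q"
            using interval_familyD(3)[OF I y, of x x'] x by auto
        qed (use interval_familyD(1,3)[OF I] in auto)
        have "norm (F q - F y) < 1"
        proof (cases "y = q")
          case False
          then show ?thesis
            using right[OF interval_family_singleton[of y y q q]] ty by (simp add: increment_sum_def)
        qed simp
        then have "norm (F y - F t) \<le> norm (F q - F t) + 1"
          using norm_triangle_ineq4[of "F q - F t" "F q - F y"] by simp
        moreover have "increment_sum F I = norm (F y - F t) + increment_sum F (I - {(t, y)})"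
          using y interval_familyD(1)[OF I] by (simp add: increment_sum_def sum.remove)
        ultimately have "increment_sum F I \<le> norm (F q - F t) + 2"
          using right[OF J] ty by auto
        then show ?thesis by (rule ennreal_leI)
      next
        case False
        have "increment_sum F I \<le> norm (F q - F t) + 2"
        proof (cases "I = {}")
          case False
          \<comment> \<open>No interval starts at \<open>t\<close>, so the least left endpoint lies
            strictly to its right and the whole family lives where \<open>right\<close>
            applies.\<close>
          define u where "u = Min (fst ` I)"
          have fin: "finite (fst ` I)" using interval_familyD(1)[OF I] by simp
          have "u \<in> fst ` I" unfolding u_def using fin \<open>I \<noteq> {}\<close> by (intro Min_in) auto
          then obtain v where v: "(u, v) \<in> I" by force
          have u: "t < u" "u \<le> q"
            using interval_familyD(2)[OF I v] \<open>\<not> (\<exists>y. (t, y) \<in> I)\<close> v by (auto simp: less_le)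
          have "interval_family u q I"
          proof (rule interval_familyI)
            fix x x' assume x: "(x, x') \<in> I"
            then have "u \<le> x" unfolding u_def using fin by (intro Min_le) force+
            then show "u \<le> x \<and> x < x' \<and> x' \<le> q" using interval_familyD(2)[OF I x] by simp
          qed (use interval_familyD(1,3)[OF I] in auto)
          then have "increment_sum F I < 1" using u by (rule right)
          then show ?thesis using norm_ge_zero[of "F q - F t"] by linarith
        qed (simp add: increment_sum_def)
        then show ?thesis by (rule ennreal_leI)
      qed
    qed
    ultimately have "variation F p q \<le> 1 + ennreal (norm (F q - F t) + 2)"
      using variation_add[of p t q F] pq by (auto intro: add_mono)
    also have "\<dots> < \<infinity>" by simp
    finally show "variation F p q < \<infinity>" .
  qed (use p0 q0 in auto)
qed

lemma g_absolutely_continuous_dominating: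
  fixes F :: "real \<Rightarrow> 'b::real_normed_vector"
  assumes F: "g_absolutely_continuous g F"
  obtains V :: "real \<Rightarrow> real" where "g_absolutely_continuous g V"
    "\<And>x y. x \<le> y \<Longrightarrow> norm (F y - F x) \<le> V y - V x"
proof -
  define w where "w x y = enn2real (variation F x y)" for x y
  have w: "ennreal (w x y) = variation F x y" if "x \<le> y" for x y
    unfolding w_def using variation_finite[OF F that] by simp
  have w_nonneg: "w x y \<ge> 0" for x y by (simp add: w_def)
  have w_add: "w x z = w x y + w y z" if "x \<le> y" "y \<le> z" for x y z
  proof -
    have "ennreal (w x z) = ennreal (w x y + w y z)"
      using variation_add[OF that, of F] that w_nonneg by (simp add: w)
    then show ?thesis using w_nonneg by (subst (asm) ennreal_inj) (auto intro: add_nonneg_nonneg)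
  qed
  \<comment> \<open>The variation function counted from 0, with negative sign to the left;
    additivity gives the increments wherever 0 lies relative to \<open>x\<close> and
    \<open>y\<close>.\<close>
  define V where "V x = (if 0 \<le> x then w 0 x else - w x 0)" for x
  have V: "V y - V x = w x y" if "x \<le> y" for x y
    using that w_add[of 0 x y] w_add[of x 0 y] w_add[of x y 0] unfolding V_def by auto
  show thesis
  proof
    show "norm (F y - F x) \<le> V y - V x" if "x \<le> y" for x y
      using norm_diff_le_variation[OF that, of F] w_nonneg by (simp add: V[OF that] w[OF that, symmetric])
    show "g_absolutely_continuous g V"
    proof (rule g_absolutely_continuousI)
      fix a b e :: real assume "a < b" "e > 0"
      \<comment> \<open>Half of \<open>e\<close>, since the bound on the sum of variations is not
        strict.\<close>
      then obtain d where d: "d > 0"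
        "\<And>I. interval_family a b I \<Longrightarrow> (\<Sum>(x, y)\<in>I. g y - g x) < d \<Longrightarrow> (\<Sum>(x, y)\<in>I. variation F x y) \<le> ennreal (e / 2)"
        using sum_variation_le[OF F, of a b "e / 2"] by auto
      show "\<exists>d>0. \<forall>I. interval_family a b I \<and> (\<Sum>(x, y)\<in>I. g y - g x) < d \<longrightarrow> increment_sum V I < e"
      proof (intro exI[of _ d] conjI d(1) allI impI)
        fix I assume I: "interval_family a b I \<and> (\<Sum>(x, y)\<in>I. g y - g x) < d"
        have le: "fst k \<le> snd k" if "k \<in> I" for k
          using I interval_familyD(2)[of a b I "fst k" "snd k"] that by auto
        have "ennreal (increment_sum V I) = (\<Sum>k\<in>I. ennreal (w (fst k) (snd k)))"
          unfolding increment_sum_def case_prod_beta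
          using le by (subst sum_ennreal) (auto intro!: arg_cong[of _ _ ennreal] sum.cong simp: V w_nonneg)
        also have "\<dots> = (\<Sum>(x, y)\<in>I. variation F x y)"
          using le by (auto intro!: sum.cong simp: w case_prod_beta)
        also have "\<dots> \<le> ennreal (e / 2)" using I by (intro d(2)) auto
        finally show "increment_sum V I < e" using \<open>e > 0\<close> by (simp add: ennreal_le_iff)
      qed
    qed
  qed
qed

text \<open>Absolute continuity speaks of finite families, the claim of Borel null sets. An open
  neighbourhood of small \<open>g\<close>-measure links them: finite dyadic families exhaust it from
  inside, each has \<open>M\<close>-measure at most \<open>e\<close>, and continuity from below
  passes the bound to the neighbourhood.\<close>

lemma absolutely_continuous_ls_measure:
  assumes M: "derivator M" and AC: "g_absolutely_continuous g M"
  shows "absolutely_continuous (ls_measure g) (ls_measure M)"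
  unfolding absolutely_continuous_def
proof
  interpret M: derivator_on_line M by unfold_locales fact
  fix A assume A: "A \<in> null_sets (ls_measure g)"
  have "A \<inter> {- real n<..<real n} \<in> null_sets (ls_measure M)" if "n > 0" for n :: nat
  proof -
    let ?a = "- real n" and ?b = "real n"
    let ?A = "A \<inter> {?a<..<?b}"
    have A_null: "?A \<in> null_sets (ls_measure g)" using A by (intro null_set_Int2) auto
    have fin: "emeasure (ls_measure g) {?a<..<?b} < \<infinity>"
      by (rule order.strict_trans1[OF emeasure_mono emeasure_Ico_finite[of ?a ?b]]) auto
    have "emeasure (ls_measure M) ?A \<le> 0 + ennreal e" if "e > 0" for e
    proof -
      obtain d where d: "d > 0" "\<And>I. interval_family ?a ?b I \<Longrightarrow> (\<Sum>(x, y)\<in>I. g y - g x) < d \<Longrightarrow> increment_sum M I < e"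
        using g_absolutely_continuousE[OF AC, of ?a ?b e] \<open>n > 0\<close> \<open>e > 0\<close> by auto
      obtain U where U: "open U" "?A \<subseteq> U" "U \<subseteq> {?a<..<?b}" "emeasure (ls_measure g) U < ennreal d"
        using open_superset_small_emeasure[OF sets_ls_measure fin A_null, of "ennreal d"] d(1) by auto
      obtain I where I: "\<And>k::nat. interval_family ?a ?b (I k)" "incseq (\<lambda>k. \<Union>(x, y)\<in>I k. {x..<y})"
          "(\<Union>k. \<Union>(x, y)\<in>I k. {x..<y}) = U"
        using open_eq_Union_dyadic[OF U(1,3)] by blast
      have I_borel: "(\<Union>(x, y)\<in>I k. {x..<y}) \<in> sets borel" for k
        using interval_familyD(1)[OF I(1)] by (intro sets.finite_UN) auto
      have le: "emeasure (ls_measure M) (\<Union>(x, y)\<in>I k. {x..<y}) \<le> ennreal e" for k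
      proof -
        have "ennreal (\<Sum>(x, y)\<in>I k. g y - g x) \<le> emeasure (ls_measure g) U"
          unfolding emeasure_interval_family[OF I(1), symmetric] I(3)[symmetric]
          using U(1) I(3) by (intro emeasure_mono) auto
        then have "ennreal (\<Sum>(x, y)\<in>I k. g y - g x) < ennreal d" using U(4) by (rule order.strict_trans1)
        moreover have "(\<Sum>(x, y)\<in>I k. g y - g x) \<ge> 0"
        proof (rule sum_nonneg)
          fix i assume "i \<in> I k"
          then have "fst i < snd i" using interval_familyD(2)[OF I(1), of "fst i" "snd i" k] by simp
          then show "0 \<le> (case i of (x, y) \<Rightarrow> g y - g x)"
            using mono_g[of "fst i" "snd i"] by (simp add: case_prod_beta)
        qed
        ultimately have "increment_sum M (I k) < e"
          by (intro d(2) I(1)) (simp add: ennreal_less_iff)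
        moreover have "(\<Sum>(x, y)\<in>I k. M y - M x) \<le> increment_sum M (I k)"
          unfolding increment_sum_def by (intro sum_mono) auto
        ultimately show ?thesis
          unfolding M.emeasure_interval_family[OF I(1)] by (intro ennreal_leI) auto
      qed
      have "emeasure (ls_measure M) ?A \<le> emeasure (ls_measure M) U"
        using U by (intro emeasure_mono) auto
      also have "\<dots> = (SUP k. emeasure (ls_measure M) (\<Union>(x, y)\<in>I k. {x..<y}))"
        unfolding I(3)[symmetric] using I(2) I_borel by (intro SUP_emeasure_incseq[symmetric]) auto
      also have "\<dots> \<le> ennreal e" using le by (intro SUP_least)
      finally show ?thesis by simp
    qed
    note le_e = this
    have "emeasure (ls_measure M) ?A \<le> 0" by (rule ennreal_le_epsilon) (rule le_e)
    then show ?thesis using A_null by (auto simp: null_sets_def)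
  qed
  note window = this
  have "(\<Union>n. A \<inter> {- real (Suc n)<..<real (Suc n)}) \<in> null_sets (ls_measure M)"
    by (intro null_sets_UN window zero_less_Suc)
  moreover have "(\<Union>n. A \<inter> {- real (Suc n)<..<real (Suc n)}) = A"
  proof (intro equalityI subsetI)
    fix x assume "x \<in> A"
    obtain n :: nat where "\<bar>x\<bar> < real n" using reals_Archimedean2 by blast
    then show "x \<in> (\<Union>n. A \<inter> {- real (Suc n)<..<real (Suc n)})"
      using \<open>x \<in> A\<close> by (intro UN_I[of n]) auto
  qed auto
  ultimately show "A \<in> null_sets (ls_measure M)" by simp
qed

section \<open>Radon-Nikodym densities of absolutely continuous functions\<close>

lemma derivator_has_g_primitive:
  assumes M: "derivator M" and AC: "g_absolutely_continuous g M"
  obtains \<phi> where "g_primitive M \<phi>"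
proof
  interpret M: derivator_on_line M by unfold_locales fact
  define \<phi> where "\<phi> = (\<lambda>x. enn2real (RN_deriv (ls_measure g) (ls_measure M) x))"
  have sets_eq: "sets (ls_measure M) = sets (ls_measure g)" by simp
  note RN = RN_deriv_integrable[OF M.sigma_finite_measure_axioms absolutely_continuous_ls_measure[OF assms] sets_eq]
    RN_deriv_integral[OF M.sigma_finite_measure_axioms absolutely_continuous_ls_measure[OF assms] sets_eq]
  show "g_primitive M \<phi>"
    unfolding g_primitive_def
  proof (intro conjI allI impI)
    have "RN_deriv (ls_measure g) (ls_measure M) \<in> borel_measurable (ls_measure g)" by simp
    then show "\<phi> \<in> borel_measurable borel" unfolding \<phi>_def by measurable
    fix x y
    have ind: "(indicator {x..<y} :: real \<Rightarrow> real) \<in> borel_measurable (ls_measure g)"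
      by (intro borel_measurable_indicator) auto
    have "integrable (ls_measure M) (indicator {x..<y} :: real \<Rightarrow> real)"
      using M.emeasure_Ico_finite by (intro integrable_real_indicator) auto
    then show "set_integrable (ls_measure g) {x..<y} \<phi>"
      unfolding RN(1)[OF ind] by (simp add: set_integrable_def \<phi>_def mult.commute)
    assume "x \<le> y"
    have "(LINT s:{x..<y}|ls_measure g. \<phi> s) = integral\<^sup>L (ls_measure M) (indicator {x..<y})"
      unfolding RN(2)[OF ind] by (simp add: set_lebesgue_integral_def \<phi>_def mult.commute)
    then show "(LINT s:{x..<y}|ls_measure g. \<phi> s) = M y - M x"
      using M.measure_Ico[OF \<open>x \<le> y\<close>] by simp
  qed
qed

text \<open>Stieltjes measures require monotone functions. Each component becomes monotone after
  adding \<open>V\<close>, whose increments dominate those of \<open>F\<close>; the density of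
  \<open>V\<close> is subtracted afterwards.\<close>

theorem g_absolutely_continuous_has_g_primitive:
  fixes F :: "real \<Rightarrow> 'b::euclidean_space"
  assumes F: "g_absolutely_continuous g F"
  obtains \<phi> where "g_primitive F \<phi>"
proof -
  obtain V :: "real \<Rightarrow> real" where V: "g_absolutely_continuous g V"
    and le: "\<And>x y. x \<le> y \<Longrightarrow> norm (F y - F x) \<le> V y - V x"
    using g_absolutely_continuous_dominating[OF F] by metis
  \<comment> \<open>The factor 2 accommodates \<open>V\<close> plus one component of
    \<open>F\<close>; the upper bound lets \<open>M\<close> inherit absolute continuity from
    \<open>V\<close>.\<close>
  have "\<exists>\<phi>. g_primitive M \<phi>" if M: "\<And>x y. x \<le> y \<Longrightarrow> 0 \<le> M y - M x \<and> M y - M x \<le> 2 * (V y - V x)" for M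
  proof -
    have AC: "g_absolutely_continuous g M"
    proof (rule g_absolutely_continuous_dominated[OF V])
      show "norm (M y - M x) \<le> 2 * norm (V y - V x)" if "x \<le> y" for x y
        using M[OF that] by auto
    qed
    moreover have "derivator M"
      unfolding derivator_def mono_def continuous_within
      using M g_absolutely_continuous_tendsto_left[OF AC] by auto
    ultimately show ?thesis using derivator_has_g_primitive by blast
  qed
  note has_primitive = this
  have V_le: "0 \<le> V y - V x" if "x \<le> y" for x y using le[OF that] norm_ge_zero order_trans by blast
  obtain v where v: "g_primitive V v" using has_primitive[of V] V_le by fastforce
  have "\<exists>\<phi>. g_primitive (\<lambda>x. (F x \<bullet> b) *\<^sub>R b) \<phi>" if "b \<in> Basis" for b
  proof -
    have "\<bar>(F y - F x) \<bullet> b\<bar> \<le> V y - V x" if "x \<le> y" for x y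
      using Basis_le_norm[OF \<open>b \<in> Basis\<close>, of "F y - F x"] le[OF that] by linarith
    then have "0 \<le> (V y + F y \<bullet> b) - (V x + F x \<bullet> b) \<and> (V y + F y \<bullet> b) - (V x + F x \<bullet> b) \<le> 2 * (V y - V x)"
      if "x \<le> y" for x y
      using that by (fastforce simp: inner_diff_left abs_le_iff)
    from has_primitive[of "\<lambda>x. V x + F x \<bullet> b", OF this]
    obtain m where m: "g_primitive (\<lambda>x. V x + F x \<bullet> b) m" by (rule exE)
    have "g_primitive (\<lambda>x. (V x + F x \<bullet> b) + (- 1) *\<^sub>R V x) (\<lambda>x. m x + (- 1) *\<^sub>R v x)"
      by (intro g_primitive_add g_primitive_cmult m v)
    then have "g_primitive (\<lambda>x. F x \<bullet> b) (\<lambda>x. m x - v x)" by simp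
    \<comment> \<open>The product rule with the constant vector \<open>b\<close> turns the scalar
      density into one along \<open>b\<close>.\<close>
    from g_primitive_mult[OF g_primitive_const[of b] this] show ?thesis by auto
  qed
  then obtain \<phi> where \<phi>: "\<And>b. b \<in> Basis \<Longrightarrow> g_primitive (\<lambda>x. (F x \<bullet> b) *\<^sub>R b) (\<phi> b)" by metis
  have "g_primitive (\<lambda>x. \<Sum>b\<in>Basis. (F x \<bullet> b) *\<^sub>R b) (\<lambda>x. \<Sum>b\<in>Basis. \<phi> b x)"
    by (intro g_primitive_sum \<phi>)
  then have "g_primitive F (\<lambda>x. \<Sum>b\<in>Basis. \<phi> b x)"
    by (simp add: euclidean_representation)
  then show thesis by (rule that)
qed


section \<open>Taylor's formula\<close>

text \<open>\<open>F s\<close> differs from \<open>F x\<close> by at most the integral of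
  \<open>norm (\<phi> r)\<close> over \<open>{x..<y}\<close>. The bound serves to make the monomials
  locally integrable.\<close>

lemma g_primitive_locally_bounded:
  fixes F :: "real \<Rightarrow> 'b::{banach, second_countable_topology}"
  assumes "g_primitive F \<phi>"
  obtains B where "\<And>s. s \<in> {x..<y} \<Longrightarrow> norm (F s) \<le> B"
proof
  fix s assume s: "s \<in> {x..<y}"
  have int: "integrable (ls_measure g) (\<lambda>r. indicator {x..<y} r *\<^sub>R \<phi> r)"
    using g_primitiveD(2)[OF assms, of x y] by (simp add: set_integrable_def)
  have int_s: "integrable (ls_measure g) (\<lambda>r. indicator {x..<s} r *\<^sub>R \<phi> r)"
    using g_primitiveD(2)[OF assms, of x s] by (simp add: set_integrable_def)
  have "norm (F s - F x) = norm (\<integral>r. indicator {x..<s} r *\<^sub>R \<phi> r \<partial>ls_measure g)"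
    using g_primitiveD(3)[OF assms, of x s] s by (simp add: set_lebesgue_integral_def)
  also have "\<dots> \<le> (\<integral>r. norm (indicator {x..<s} r *\<^sub>R \<phi> r) \<partial>ls_measure g)"
    by (rule integral_norm_bound)
  also have "\<dots> \<le> (\<integral>r. norm (indicator {x..<y} r *\<^sub>R \<phi> r) \<partial>ls_measure g)"
    using int int_s s by (intro integral_mono integrable_norm) (auto simp: indicator_def)
  finally show "norm (F s) \<le> norm (F x) + (\<integral>r. norm (indicator {x..<y} r *\<^sub>R \<phi> r) \<partial>ls_measure g)"
    using norm_triangle_sub[of "F s" "F x"] by linarith
qed

lemma locally_integrable_bounded:
  fixes F :: "real \<Rightarrow> 'b::{banach, second_countable_topology}" and \<phi> :: "real \<Rightarrow> real"
  assumes F: "F \<in> borel_measurable borel" "\<And>s. s \<in> {x..<y} \<Longrightarrow> norm (F s) \<le> B"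
    and \<phi>: "set_integrable (ls_measure g) {x..<y} \<phi>"
  shows "set_integrable (ls_measure g) {x..<y} (\<lambda>s. \<phi> s *\<^sub>R F s)"
  unfolding set_integrable_def
proof (rule Bochner_Integration.integrable_bound)
  show "integrable (ls_measure g) (\<lambda>s. B * (indicator {x..<y} s *\<^sub>R \<phi> s))"
    using \<phi> by (simp add: set_integrable_def)
  have "(\<lambda>s. indicator {x..<y} s *\<^sub>R \<phi> s) \<in> borel_measurable (ls_measure g)"
    using \<phi> by (auto simp: set_integrable_def)
  moreover have "F \<in> borel_measurable (ls_measure g)" using F(1) by simp
  ultimately have "(\<lambda>s. (indicator {x..<y} s *\<^sub>R \<phi> s) *\<^sub>R F s) \<in> borel_measurable (ls_measure g)"
    by (rule borel_measurable_scaleR)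
  then show "(\<lambda>s. indicator {x..<y} s *\<^sub>R (\<phi> s *\<^sub>R F s)) \<in> borel_measurable (ls_measure g)" by simp
  have "norm (indicator {x..<y} s *\<^sub>R \<phi> s *\<^sub>R F s) \<le> norm (B * (indicator {x..<y} s *\<^sub>R \<phi> s))" for s
  proof (cases "s \<in> {x..<y}")
    case True
    then have "norm (F s) \<le> \<bar>B\<bar>" using F(2) by fastforce
    then have "\<bar>\<phi> s\<bar> * norm (F s) \<le> \<bar>\<phi> s\<bar> * \<bar>B\<bar>" by (intro mult_left_mono) auto
    then show ?thesis using True by (simp add: abs_mult mult.commute)
  qed simp
  then show "AE s in ls_measure g. norm (indicator {x..<y} s *\<^sub>R \<phi> s *\<^sub>R F s) \<le> norm (B * (indicator {x..<y} s *\<^sub>R \<phi> s))"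
    by simp
qed

text \<open>Every locally integrable density has a primitive, given by the very
  \<open>g_integral\<close> that defines \<open>g_monomial\<close>, even when the integrand is only
  an almost-everywhere version of the density.\<close>

lemma g_primitive_g_integral:
  fixes \<phi> :: "real \<Rightarrow> 'b::{banach, second_countable_topology}"
  assumes borel: "\<phi> \<in> borel_measurable borel" and int: "locally_integrable \<phi>"
    and AE: "AE s in ls_measure g. \<phi>' s = \<phi> s"
  shows "g_primitive (\<lambda>x. g_integral g a x \<phi>') \<phi>"
proof -
  define F where "F x = (if a \<le> x then (LINT s:{a..<x}|ls_measure g. \<phi> s) else - (LINT s:{x..<a}|ls_measure g. \<phi> s))" for x
  have add: "(LINT s:{x..<z}|ls_measure g. \<phi> s) = (LINT s:{x..<y}|ls_measure g. \<phi> s) + (LINT s:{y..<z}|ls_measure g. \<phi> s)"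
    if "x \<le> y" "y \<le> z" for x y z
  proof -
    have "{x..<z} = {x..<y} \<union> {y..<z}" using that by auto
    then show ?thesis using int by (subst set_integral_Un[symmetric]) auto
  qed
  have F: "g_primitive F \<phi>"
    unfolding g_primitive_def
  proof (intro conjI borel int allI impI)
    fix x y :: real assume "x \<le> y"
    then show "(LINT s:{x..<y}|ls_measure g. \<phi> s) = F y - F x"
      using add[of a x y] add[of x a y] add[of x y a] unfolding F_def
      by (auto simp: algebra_simps)
  qed
  have "F a = 0" by (simp add: F_def set_lebesgue_integral_def)
  then have "(\<lambda>x. g_integral g a x \<phi>') = F"
    using g_integral_g_primitive(2)[OF F AE] by auto
  then show ?thesis using F by simp
qed

text \<open>Each \<open>p k\<close> is an explicit Borel version of the derivative of the monomial.
  Putting it in place of \<open>g_deriv\<close> changes the defining integrand on a null set only,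
  and the recursion becomes an identity at every point.\<close>

lemma g_monomial_has_g_primitive:
  obtains p where "\<And>k. g_primitive (g_monomial g a k) (p k)" "p 0 = (\<lambda>s. 0)"
    "\<And>k. p (Suc k) = (\<lambda>s. real (Suc k) * (g_monomial g a k s + jump g s * p k s))"
proof -
  define p where "p = rec_nat (\<lambda>s. 0) (\<lambda>k q s. real (Suc k) * (g_monomial g a k s + jump g s * q s))"
  have p0: "p 0 = (\<lambda>s. 0)" by (simp add: p_def)
  have pSuc: "p (Suc k) = (\<lambda>s. real (Suc k) * (g_monomial g a k s + jump g s * p k s))" for k
    by (simp add: p_def)
  have "g_primitive (g_monomial g a k) (p k)" for k
  proof (induction k)
    case 0
    show ?case using g_primitive_const[of "1 :: real"] by (simp add: p0)
  next
    case (Suc k)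
    let ?\<phi> = "\<lambda>s. g_monomial g a k s + jump g s * p k s"
    note [measurable] = g_primitive_borel_measurable[OF Suc] g_primitiveD(1)[OF Suc]
    have "locally_integrable ?\<phi>"
    proof (intro allI set_integral_add(1))
      fix x y
      obtain B where B: "\<And>s. s \<in> {x..<y} \<Longrightarrow> norm (g_monomial g a k s) \<le> B"
        using g_primitive_locally_bounded[OF Suc] by blast
      show "set_integrable (ls_measure g) {x..<y} (g_monomial g a k)"
        using locally_integrable_bounded[OF g_primitive_borel_measurable[OF Suc] B set_integrable_const_Ico[of x y "1 :: real"]]
        by simp
      \<comment> \<open>On \<open>{x..<y}\<close> a jump is at most the total increment, so
        \<open>jump g\<close> is a bounded factor of \<open>p k\<close>.\<close>
      have "norm (jump g s) \<le> g y - g x" if "s \<in> {x..<y}" for s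
        using jump_le[of s y] jump_nonneg[of s] mono_g[of x s] that by auto
      from locally_integrable_bounded[OF jump_borel_measurable this g_primitiveD(2)[OF Suc]]
      show "set_integrable (ls_measure g) {x..<y} (\<lambda>s. jump g s * p k s)"
        by (simp add: mult.commute)
    qed
    moreover have "AE s in ls_measure g. g_monomial g a k s + g_deriv g (g_monomial g a k) s * jump g s = ?\<phi> s"
      using g_deriv_g_primitive[OF Suc] by eventually_elim simp
    ultimately have "g_primitive (\<lambda>x. g_integral g a x (\<lambda>s. g_monomial g a k s + g_deriv g (g_monomial g a k) s * jump g s)) ?\<phi>"
      by (intro g_primitive_g_integral) measurable
    from g_primitive_cmult[OF this, of "real (Suc k)"] show ?case
      by (simp add: pSuc)
  qed
  then show thesis using p0 pSuc by (rule that)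
qed

lemma g_monomial_self: "g_monomial g a (Suc k) a = 0"
  by (simp add: g_integral_def set_lebesgue_integral_def)

end

theorem theorem8p3:
  fixes g :: "real \<Rightarrow> real"
    and f :: "real \<Rightarrow> 'a::{real_normed_field, euclidean_space}"
    and n :: nat
    and t t0 :: real
  assumes "derivator g"
    and "n \<ge> 1"
    and "times_g_differentiable (n - 1) g f"
    and "\<forall>k\<in>{0..n - 1}. g_absolutely_continuous g (g_deriv_iter g k f)"
  shows "g_integrable g t0 t
           (\<lambda>s. (-1) ^ (n - 1) * g_deriv_iter g n f s *
             of_real (g_deriv g (\<lambda>r. 1 / fact n * g_monomial g t n r) s)) \<and>
         f t =
           (\<Sum>k=0..n - 1. (-1) ^ k * g_deriv_iter g k f t0 *
             of_real (1 / fact k * g_monomial g t k t0)) +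
           g_integral g t0 t
             (\<lambda>s. (-1) ^ (n - 1) * g_deriv_iter g n f s *
               of_real (g_deriv g (\<lambda>r. 1 / fact n * g_monomial g t n r) s))"
proof -
  interpret derivator_on_line g by unfold_locales fact
  define D where "D k = g_deriv_iter g k f" for k
  define u where "u k = (\<lambda>s. 1 / fact k * g_monomial g t k s)" for k
  obtain p where p: "\<And>k. g_primitive (g_monomial g t k) (p k)" "p 0 = (\<lambda>s. 0)"
      "\<And>k. p (Suc k) = (\<lambda>s. real (Suc k) * (g_monomial g t k s + jump g s * p k s))"
    using g_monomial_has_g_primitive[of t] by metis
  define q where "q k = (\<lambda>s. 1 / fact k * p k s)" for k
  have u_q: "g_primitive (u k) (q k)" for k
    using g_primitive_cmult[OF p(1), of "1 / fact k" k] by (simp add: u_def q_def)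
  \<comment> \<open>The factorials absorb the factor \<open>Suc k\<close>. The right side is the
    right limit of \<open>u k\<close> at \<open>s\<close>, the same coefficient that the product
    rule puts before the density of \<open>D k\<close>.\<close>
  have q_Suc: "q (Suc k) s = u k s + jump g s * q k s" for k s
  proof -
    have "1 / fact (Suc k) * real (Suc k) = (1 / fact k :: real)"
      by (simp add: fact_Suc del: of_nat_Suc)
    then have "q (Suc k) s = 1 / fact k * (g_monomial g t k s + jump g s * p k s)"
      unfolding q_def p(3) by (metis mult.assoc)
    then show ?thesis by (simp add: u_def q_def algebra_simps)
  qed
  \<comment> \<open>Absolute continuity reaches up to \<open>n - 1\<close>; \<open>D n\<close>
    enters only as an almost-everywhere version of the density of \<open>D (n - 1)\<close>.\<close>
  have "\<exists>\<phi>. g_primitive (D k) \<phi>" if "k < n" for k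
  proof -
    have "g_absolutely_continuous g (D k)" using assms(4) that by (auto simp: D_def)
    then show ?thesis by (rule g_absolutely_continuous_has_g_primitive) auto
  qed
  then obtain \<phi> where \<phi>: "\<And>k. k < n \<Longrightarrow> g_primitive (D k) (\<phi> k)" by metis
  have D_Suc: "AE s in ls_measure g. D (Suc k) s = \<phi> k s" if "k < n" for k
    using g_deriv_g_primitive[OF \<phi>[OF that]] by (simp add: D_def g_deriv_iter_def)
  define H where "H s = (\<Sum>k<n. (- 1) ^ k *\<^sub>R (u k s *\<^sub>R D k s))" for s
  define \<eta> where "\<eta> s = (\<Sum>k<n. (- 1) ^ k *\<^sub>R ((u k s + jump g s * q k s) *\<^sub>R \<phi> k s + q k s *\<^sub>R D k s))" for s
  have H: "g_primitive H \<eta>"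
    unfolding H_def \<eta>_def
    by (intro g_primitive_sum g_primitive_cmult g_primitive_mult \<phi> u_q) auto
  \<comment> \<open>Neighbouring terms share \<open>q (Suc k) s *\<^sub>R D (Suc k) s\<close> with
    opposite signs. The lower end vanishes because \<open>q 0\<close> is 0, and the upper end keeps
    the sign of the last index \<open>m - 1\<close>.\<close>
  have telescope: "(\<Sum>k<m. (- 1) ^ k *\<^sub>R (q (Suc k) s *\<^sub>R D (Suc k) s + q k s *\<^sub>R D k s))
      = (if m = 0 then 0 else (- 1) ^ (m - 1) *\<^sub>R (q m s *\<^sub>R D m s))" for m s
  proof (induction m)
    case (Suc m)
    have "q 0 s = 0" by (simp add: q_def p(2))
    then show ?case using Suc by (cases m) (auto simp: algebra_simps)
  qed simp
  have "AE s in ls_measure g. \<forall>k<n. D (Suc k) s = \<phi> k s"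
    using D_Suc by (simp add: AE_all_countable)
  moreover have "AE s in ls_measure g. g_deriv g (u n) s = q n s" using u_q by (rule g_deriv_g_primitive)
  ultimately have AE: "AE s in ls_measure g. (-1) ^ (n - 1) * D n s * of_real (g_deriv g (u n) s) = \<eta> s"
  proof eventually_elim
    case (elim s)
    have "\<eta> s = (\<Sum>k<n. (- 1) ^ k *\<^sub>R (q (Suc k) s *\<^sub>R D (Suc k) s + q k s *\<^sub>R D k s))"
      using elim(1) unfolding \<eta>_def q_Suc by (intro sum.cong) auto
    also have "\<dots> = (- 1) ^ (n - 1) *\<^sub>R (q n s *\<^sub>R D n s)" using \<open>n \<ge> 1\<close> by (simp add: telescope)
    finally show ?case using elim(2) by (simp add: scaleR_conv_of_real mult_ac)
  qed
  \<comment> \<open>The monomials are centred at \<open>t\<close>, where only \<open>k = 0\<close>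
    survives; so \<open>H\<close> returns \<open>f\<close> at the evaluation point, and its value at
    \<open>t0\<close> is the Taylor sum.\<close>
  have "H t = f t"
  proof -
    have "H t = (\<Sum>k\<in>{0}. (- 1) ^ k *\<^sub>R (u k t *\<^sub>R D k t))"
      unfolding H_def
    proof (rule sum.mono_neutral_right)
      show "\<forall>k\<in>{..<n} - {0}. (- 1) ^ k *\<^sub>R (u k t *\<^sub>R D k t) = 0"
      proof
        fix k assume "k \<in> {..<n} - {0}"
        then obtain j where "k = Suc j" by (cases k) auto
        then have "u k t = 0" using g_monomial_self[of t j] by (simp only: u_def mult_zero_right)
        then show "(- 1) ^ k *\<^sub>R (u k t *\<^sub>R D k t) = 0" by simp
      qed
    qed (use \<open>n \<ge> 1\<close> in auto)
    then show ?thesis by (simp add: u_def D_def g_deriv_iter_def)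
  qed
  moreover have "H t0 = (\<Sum>k=0..n - 1. (-1) ^ k * D k t0 * of_real (u k t0))"
    unfolding H_def using \<open>n \<ge> 1\<close>
    by (intro sum.cong) (auto simp: scaleR_conv_of_real mult_ac)
  ultimately show ?thesis
    using g_integral_g_primitive[OF H AE, of t0 t] unfolding u_def D_def by simp
qed

end
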